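(* Let $n\ge 2$ be an integer, let $J=[a,b]$ and let $f:J\to\mathbb R$ be continuously differentiable with $c_5:=\sup_{x\in J}|f'(x)|<\infty$ and $\#\{x: f(x)=x\}<\infty$. Let $0<\lambda<\tfrac34$, let $c_3>0$ be a sufficiently large constant, and for $Q>0$ set $$L_J(Q,\lambda)=\Big\{(x_1,x_2)\in\mathbb R^2:\ |x_2-f(x_1)|<\big(\tfrac12+c_5\big)c_3Q^{-\lambda},\ x_1\in J\Big\}.$$ Then there exists $c_6=c_6(J,f,n)>0$ such that $$\#\big(\mathcal A_n^2(Q)\cap L_J(Q,\lambda)\big)\ge c_6\,Q^{n+1-\lambda}$$ for all $Q>Q_0(J,f,n,\lambda)$.
   Context: For $Q>0$, $\mathcal P_n(Q)$ denotes the set of polynomials $P\in\mathbb Z[t]$ with $\deg P\le n$ and height $H(P)=\max_j|a_j|\le Q$. A point $\boldsymbol\alpha=(\alpha_1,\alpha_2)\in\mathbb R^2$ is an algebraic point if $\alpha_1,\alpha_2$ are roots of a common polynomial in $\mathbb Z[t]$; its minimal polynomial is the polynomial of smallest degree in $\mathbb Z[t]$ vanishing at $\alpha_1$ and $\alpha_2$ with coprime coefficients, and the degree and height of $\boldsymbol\alpha$ are those of its minimal polynomial. $\mathcal A_n^2(Q)$ is the set of algebraic points of degree at most $n$ and height at most $Q$. *)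

theory Defs
  imports "HOL-Analysis.Analysis" "HOL-Computational_Algebra.Computational_Algebra"
begin

definition vanishes_at :: "int poly \<Rightarrow> real \<times> real \<Rightarrow> bool" where
  "vanishes_at P \<alpha> \<longleftrightarrow>
     poly (map_poly of_int P) (fst \<alpha>) = 0 \<and> poly (map_poly of_int P) (snd \<alpha>) = 0"

definition poly_height :: "int poly \<Rightarrow> int" where
  "poly_height P = Max ((\<lambda>j. \<bar>coeff P j\<bar>) ` {..degree P})"

definition algebraic_point :: "real \<times> real \<Rightarrow> bool" where
  "algebraic_point \<alpha> \<longleftrightarrow> (\<exists>P. P \<noteq> 0 \<and> vanishes_at P \<alpha>)"

(* P need not be irreducible: the coordinates may have different minimal polynomials. *)
definition is_minimal_poly :: "int poly \<Rightarrow> real \<times> real \<Rightarrow> bool" where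
  "is_minimal_poly P \<alpha> \<longleftrightarrow>
     P \<noteq> 0 \<and> vanishes_at P \<alpha> \<and> content P = 1 \<and>
     (\<forall>R. R \<noteq> 0 \<and> vanishes_at R \<alpha> \<longrightarrow> degree P \<le> degree R)"

(* The choice is only between P and - P, see minimal_poly_unique and minimal_poly_exists below. *)
definition minimal_poly :: "real \<times> real \<Rightarrow> int poly" where
  "minimal_poly \<alpha> = (SOME P. is_minimal_poly P \<alpha>)"

definition point_degree :: "real \<times> real \<Rightarrow> nat" where
  "point_degree \<alpha> = degree (minimal_poly \<alpha>)"

definition point_height :: "real \<times> real \<Rightarrow> int" where
  "point_height \<alpha> = poly_height (minimal_poly \<alpha>)"

definition algebraic_points :: "nat \<Rightarrow> real \<Rightarrow> (real \<times> real) set" where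
  "algebraic_points n Q =
     {\<alpha>. algebraic_point \<alpha> \<and> point_degree \<alpha> \<le> n \<and> of_int (point_height \<alpha>) \<le> Q}"

definition strip ::
  "real set \<Rightarrow> (real \<Rightarrow> real) \<Rightarrow> real \<Rightarrow> real \<Rightarrow> real \<Rightarrow> real \<Rightarrow> (real \<times> real) set" where
  "strip J f c5 c3 Q l =
     {(x1, x2). \<bar>x2 - f x1\<bar> < (1/2 + c5) * c3 * Q powr (- l) \<and> x1 \<in> J}"

lemma vanishes_at_smult_diff:
  assumes "vanishes_at P \<alpha>" "vanishes_at R \<alpha>"
  shows "vanishes_at (smult k P - smult m R) \<alpha>"
proof -
  have "map_poly of_int (smult k P - smult m R) =
      smult (of_int k) (map_poly of_int P) - smult (of_int m) (map_poly of_int R :: real poly)"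
    by (rule poly_eqI) (simp add: coeff_map_poly)
  thus ?thesis using assms by (simp add: vanishes_at_def)
qed

lemma minimal_poly_unique:
  assumes P: "is_minimal_poly P \<alpha>" and M: "is_minimal_poly M \<alpha>"
  shows "P = M \<or> P = - M"
proof -
  have deg: "degree P = degree M"
    using P M unfolding is_minimal_poly_def by (meson antisym)
  define R where "R = smult (lead_coeff M) P - smult (lead_coeff P) M"
  have "vanishes_at R \<alpha>"
    using P M unfolding R_def is_minimal_poly_def by (blast intro: vanishes_at_smult_diff)
  moreover have "coeff R (degree P) = 0" "degree R \<le> degree P"
    using deg by (auto simp: R_def mult.commute intro!: degree_diff_le)
  ultimately have "R = 0"
    using P unfolding is_minimal_poly_def by (metis antisym leading_coeff_0_iff)
  hence eq: "smult (lead_coeff M) P = smult (lead_coeff P) M"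
    by (simp add: R_def)
  hence "content (smult (lead_coeff M) P) = content (smult (lead_coeff P) M)"
    by simp
  hence "\<bar>lead_coeff M\<bar> = \<bar>lead_coeff P\<bar>"
    using P M by (simp add: is_minimal_poly_def)
  hence "lead_coeff P = lead_coeff M \<or> lead_coeff P = - lead_coeff M"
    by linarith
  moreover have "lead_coeff M \<noteq> 0"
    using M by (simp add: is_minimal_poly_def)
  moreover have "P = - M" if "lead_coeff P = - lead_coeff M"
  proof -
    have "smult (lead_coeff M) P = smult (lead_coeff M) (- M)"
      using eq that by simp
    thus ?thesis using \<open>lead_coeff M \<noteq> 0\<close> by (metis smult_cancel)
  qed
  ultimately show ?thesis using eq by (metis smult_cancel)
qed

lemma minimal_poly_exists:
  assumes "algebraic_point \<alpha>"
  shows "is_minimal_poly (minimal_poly \<alpha>) \<alpha>"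
proof -
  let ?S = "\<lambda>P. P \<noteq> 0 \<and> vanishes_at P \<alpha>"
  obtain P where P: "?S P" and min: "\<And>R. ?S R \<Longrightarrow> degree P \<le> degree R"
    using assms ex_has_least_nat[of ?S _ degree] unfolding algebraic_point_def by blast
  have "map_poly of_int P =
      smult (of_int (content P)) (map_poly of_int (primitive_part P) :: real poly)"
  proof (rule poly_eqI)
    fix j
    have "coeff P j = content P * coeff (primitive_part P) j"
      by (metis coeff_smult content_times_primitive_part)
    thus "coeff (map_poly of_int P) j =
        coeff (smult (of_int (content P)) (map_poly of_int (primitive_part P)) :: real poly) j"
      by (simp add: coeff_map_poly flip: of_int_mult)
  qed
  hence "vanishes_at (primitive_part P) \<alpha>"
    using P by (auto simp: vanishes_at_def)
  hence "is_minimal_poly (primitive_part P) \<alpha>"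
    using P min by (auto simp: is_minimal_poly_def)
  thus ?thesis unfolding minimal_poly_def by (rule someI)
qed

end

theory Submission
  imports Defs "HOL-Real_Asymp.Real_Asymp"
begin

text \<open>
  About \<open>1 / r\<close> disjoint squares of radius \<open>r = Q\<^sup>-\<^sup>\<lambda>\<close> can be centred at points \<open>(x, f x)\<close> of the
  graph that stay away from the diagonal, so it suffices to find of the order of \<open>Q\<^sup>n\<^sup>+\<^sup>1 r\<^sup>2\<close>
  algebraic points in one such square. Choose the coefficients \<open>a\<^sub>2, \<dots>, a\<^sub>n\<close> of size comparable to
  \<open>Q\<close>, with \<open>a\<^sub>2\<close> dominant; there are unique real \<open>a\<^sub>0, a\<^sub>1\<close> for which the polynomial vanishes at
  \<open>x\<close> and \<open>f x\<close>. Its derivative there has size comparable to \<open>Q\<close>, so \<open>a\<^sub>0\<close> and \<open>a\<^sub>1\<close> may be moved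
  by a small multiple of \<open>Q r\<close> without the two zeros leaving the square. As \<open>\<lambda> < 1\<close>, this leaves of
  the order of \<open>(Q r)\<^sup>2\<close> integral choices, hence \<open>Q\<^sup>n\<^sup>-\<^sup>1 (Q r)\<^sup>2\<close> polynomials.

  To see that different polynomials give different points, only polynomials satisfying Eisenstein's
  criterion at 2 are used, and those with nontrivial content are discarded: an odd prime \<open>p\<close>
  dividing \<open>a\<^sub>n\<close> removes at most a proportion of about \<open>1 / p\<^sup>2\<close> of the pairs \<open>(a\<^sub>0, a\<^sub>1)\<close>, and
  these proportions sum to at most one half. The remaining polynomials are minimal polynomials of
  their points.
\<close>

section \<open>Integer polynomials\<close>

abbreviation real_poly :: "int poly \<Rightarrow> real poly" where
  "real_poly \<equiv> map_poly of_int"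

lemma real_poly_mult: "real_poly (P * R) = real_poly P * real_poly R"
  by (rule poly_eqI) (simp add: coeff_map_poly coeff_mult)

definition eisenstein :: "'a :: comm_semiring_1 \<Rightarrow> 'a poly \<Rightarrow> bool" where
  "eisenstein p P \<longleftrightarrow>
     \<not> p dvd lead_coeff P \<and> (\<forall>i<degree P. p dvd coeff P i) \<and> \<not> p\<^sup>2 dvd coeff P 0"

lemma prime_not_dvd_coeff_mult:
  fixes A B :: "'a :: comm_ring_1 poly"
  assumes p: "prime_elem p" and A: "\<not> p dvd coeff A k" "\<And>i. i < k \<Longrightarrow> p dvd coeff A i"
    and B: "\<not> p dvd coeff B 0"
  shows "\<not> p dvd coeff (A * B) k"
proof -
  have "coeff (A * B) k = (\<Sum>i<k. coeff A i * coeff B (k - i)) + coeff A k * coeff B 0"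
    by (simp add: coeff_mult flip: lessThan_Suc_atMost)
  moreover have "p dvd (\<Sum>i<k. coeff A i * coeff B (k - i))"
    by (intro dvd_sum) (auto intro: dvd_mult2 A)
  moreover have "\<not> p dvd coeff A k * coeff B 0"
    using p A(1) B by (simp add: prime_elem_dvd_mult_iff)
  ultimately show ?thesis by (simp add: dvd_add_right_iff)
qed

lemma eisenstein_mult_degree_eq_0:
  fixes A B :: "'a :: idom poly"
  assumes p: "prime_elem p" and AB: "eisenstein p (A * B)" and B: "\<not> p dvd coeff B 0"
  shows "degree B = 0"
proof -
  have lead: "\<not> p dvd lead_coeff A" and "A * B \<noteq> 0"
    using AB by (auto simp: eisenstein_def lead_coeff_mult)
  define k where "k = (LEAST i. \<not> p dvd coeff A i)"
  have "\<not> p dvd coeff A k" "k \<le> degree A"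
    unfolding k_def using lead by (rule LeastI, rule Least_le)
  moreover have "p dvd coeff A i" if "i < k" for i
    using that not_less_Least unfolding k_def by blast
  ultimately have "\<not> p dvd coeff (A * B) k"
    using p B by (intro prime_not_dvd_coeff_mult)
  hence "degree (A * B) \<le> k"
    using AB unfolding eisenstein_def by (meson not_le)
  moreover have "degree (A * B) = degree A + degree B"
    using \<open>A * B \<noteq> 0\<close> by (auto simp: degree_mult_eq)
  ultimately show ?thesis using \<open>k \<le> degree A\<close> by simp
qed

lemma eisenstein_factor_degree_eq_0:
  fixes A B :: "'a :: idom poly"
  assumes "prime_elem p" "eisenstein p (A * B)"
  shows "degree A = 0 \<or> degree B = 0"
proof -
  have "\<not> (p dvd coeff A 0 \<and> p dvd coeff B 0)"
    using assms(2) by (auto simp: eisenstein_def coeff_mult_0 power2_eq_square intro: mult_dvd_mono)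
  thus ?thesis
    using assms eisenstein_mult_degree_eq_0[of p A B] eisenstein_mult_degree_eq_0[of p B A]
    by (auto simp: mult.commute)
qed

lemma content_eq_1I:
  fixes P :: "int poly"
  assumes "coprime (gcd (coeff P i) (coeff P j)) (coeff P k)"
  shows "content P = 1"
proof -
  have "is_unit (content P)"
    by (rule coprime_common_divisor[OF assms]) simp_all
  thus ?thesis using is_unit_content_iff by blast
qed

definition polys_with_coeffs_in :: "nat \<Rightarrow> (nat \<Rightarrow> 'a :: zero set) \<Rightarrow> 'a poly set" where
  "polys_with_coeffs_in n A = {P. degree P \<le> n \<and> (\<forall>i\<le>n. coeff P i \<in> A i)}"

lemma bij_betw_polys_with_coeffs_in:
  "bij_betw (\<lambda>P. restrict (coeff P) {..n}) (polys_with_coeffs_in n A) (PiE {..n} A)"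
proof (rule bij_betwI[where g = "\<lambda>c. Poly (map c [0..<Suc n])"])
  have Poly: "coeff (Poly (map c [0..<Suc n])) i = (if i \<le> n then c i else 0)" for c i
    by (auto simp: nth_default_def simp del: upt_Suc)
  show "(\<lambda>c. Poly (map c [0..<Suc n])) \<in> PiE {..n} A \<rightarrow> polys_with_coeffs_in n A"
    by (auto simp: polys_with_coeffs_in_def Poly PiE_iff simp del: upt_Suc coeff_Poly_eq
        intro!: degree_le)
  show "Poly (map (restrict (coeff P) {..n}) [0..<Suc n]) = P"
    if "P \<in> polys_with_coeffs_in n A" for P
    using that
    by (intro poly_eqI)
      (auto simp: Poly polys_with_coeffs_in_def coeff_eq_0 simp del: upt_Suc coeff_Poly_eq)
  show "restrict (coeff (Poly (map c [0..<Suc n]))) {..n} = c" if "c \<in> PiE {..n} A" for c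
    using that
    by (intro ext) (auto simp: Poly PiE_def extensional_def simp del: upt_Suc coeff_Poly_eq)
qed (auto simp: polys_with_coeffs_in_def)

lemma finite_polys_with_coeffs_in:
  "(\<And>i. i \<le> n \<Longrightarrow> finite (A i)) \<Longrightarrow> finite (polys_with_coeffs_in n A)"
  by (subst bij_betw_finite[OF bij_betw_polys_with_coeffs_in]) (auto intro: finite_PiE)

lemma card_polys_with_coeffs_in: "card (polys_with_coeffs_in n A) = (\<Prod>i\<le>n. card (A i))"
  by (subst bij_betw_same_card[OF bij_betw_polys_with_coeffs_in]) (simp add: card_PiE)

section \<open>Minimal polynomials and algebraic points\<close>

lemma vanishes_at_dvd:
  assumes "vanishes_at M \<alpha>" "M dvd P"
  shows "vanishes_at P \<alpha>"
  using assms by (auto simp: vanishes_at_def real_poly_mult elim!: dvdE)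

lemma vanishes_at_imp_degree_pos:
  assumes "vanishes_at P \<alpha>" "P \<noteq> 0"
  shows "degree P > 0"
proof (rule ccontr)
  assume "\<not> degree P > 0"
  then obtain c where "P = [:c:]" by (meson degree_eq_zeroE not_gr_zero)
  thus False using assms by (auto simp: vanishes_at_def map_poly_pCons)
qed

lemma is_minimal_poly_dvd:
  assumes M: "is_minimal_poly M \<alpha>" and P: "vanishes_at P \<alpha>"
  shows "M dvd P"
proof -
  have "M \<noteq> 0" and primitive: "content M = 1" using M by (auto simp: is_minimal_poly_def)
  define R where "R = pseudo_mod P M"
  obtain c S where "c \<noteq> 0" and division: "smult c P = M * S + R"
    using pseudo_mod(1)[OF \<open>M \<noteq> 0\<close>] unfolding R_def by blast
  have "vanishes_at (smult c P - smult 1 (M * S)) \<alpha>"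
    using M P by (intro vanishes_at_smult_diff vanishes_at_dvd[of M \<alpha> "M * S"])
      (auto simp: is_minimal_poly_def)
  hence "vanishes_at R \<alpha>" by (simp add: division)
  moreover have "R = 0 \<or> degree R < degree M"
    using pseudo_mod(2)[OF \<open>M \<noteq> 0\<close>] unfolding R_def by blast
  ultimately have "R = 0" using M unfolding is_minimal_poly_def by (meson not_le)
  hence "fract_poly M dvd smult (to_fract c) (fract_poly P)"
    using division by (metis add.right_neutral dvd_triv_left fract_poly_dvd fract_poly_smult)
  hence "fract_poly M dvd fract_poly P"
    using \<open>c \<noteq> 0\<close> by (simp add: dvd_smult_iff)
  thus ?thesis using primitive by (rule fract_poly_dvdD)
qed

lemma is_minimal_poly_eisenstein:
  assumes p: "prime_elem p" and P: "eisenstein p P" "content P = 1" "vanishes_at P \<alpha>"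
  shows "is_minimal_poly P \<alpha>"
proof -
  have "P \<noteq> 0" using P(1) by (auto simp: eisenstein_def)
  define M where "M = minimal_poly \<alpha>"
  have M: "is_minimal_poly M \<alpha>"
    unfolding M_def using \<open>P \<noteq> 0\<close> P(3)
    by (intro minimal_poly_exists) (auto simp: algebraic_point_def)
  obtain S where S: "P = M * S" using is_minimal_poly_dvd[OF M P(3)] by (auto elim: dvdE)
  have "degree M > 0"
    using M by (auto simp: is_minimal_poly_def intro: vanishes_at_imp_degree_pos)
  hence "degree S = 0" using eisenstein_factor_degree_eq_0[OF p, of M S] P(1) by (simp add: S)
  hence "degree P = degree M"
    using \<open>P \<noteq> 0\<close> by (auto simp: S degree_mult_eq)
  thus ?thesis using M P \<open>P \<noteq> 0\<close> by (auto simp: is_minimal_poly_def)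
qed

lemma abs_coeff_le_poly_height: "\<bar>coeff P i\<bar> \<le> poly_height P"
proof -
  have coeff_le_height: "\<bar>coeff P j\<bar> \<le> poly_height P" if "j \<le> degree P" for j
    unfolding poly_height_def using that by (intro Max_ge) auto
  show ?thesis
    using coeff_le_height[of i] coeff_le_height[of 0]
    by (cases "i \<le> degree P") (auto simp: coeff_eq_0)
qed

lemma finite_algebraic_points: "finite (algebraic_points n Q)"
proof (rule finite_subset)
  let ?Ps = "polys_with_coeffs_in n (\<lambda>_. {- \<lfloor>Q\<rfloor>..\<lfloor>Q\<rfloor>}) - {0}"
  let ?roots = "\<lambda>P. {t. poly (real_poly P) t = 0}"
  show "algebraic_points n Q \<subseteq> (\<Union>P\<in>?Ps. ?roots P \<times> ?roots P)"
  proof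
    fix \<alpha> assume \<alpha>: "\<alpha> \<in> algebraic_points n Q"
    hence M: "is_minimal_poly (minimal_poly \<alpha>) \<alpha>"
      by (intro minimal_poly_exists) (simp add: algebraic_points_def)
    have "poly_height (minimal_poly \<alpha>) \<le> \<lfloor>Q\<rfloor>"
      using \<alpha> by (simp add: algebraic_points_def point_height_def le_floor_iff)
    hence "coeff (minimal_poly \<alpha>) i \<in> {- \<lfloor>Q\<rfloor>..\<lfloor>Q\<rfloor>}" for i
      using abs_coeff_le_poly_height[of "minimal_poly \<alpha>" i] by auto
    hence "minimal_poly \<alpha> \<in> ?Ps"
      using \<alpha> M by (simp add: algebraic_points_def point_degree_def is_minimal_poly_def
          polys_with_coeffs_in_def)
    thus "\<alpha> \<in> (\<Union>P\<in>?Ps. ?roots P \<times> ?roots P)"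
      using M by (intro UN_I[of "minimal_poly \<alpha>"])
        (auto simp: is_minimal_poly_def vanishes_at_def mem_Times_iff)
  qed
  have "finite (?roots P)" if "P \<noteq> 0" for P
    using that by (intro poly_roots_finite) (simp add: map_poly_eq_0_iff)
  thus "finite (\<Union>P\<in>?Ps. ?roots P \<times> ?roots P)"
    by (intro finite_UN_I finite_Diff finite_polys_with_coeffs_in finite_cartesian_product) auto
qed

lemma minimal_poly_cases:
  assumes "is_minimal_poly P \<alpha>"
  shows "minimal_poly \<alpha> = P \<or> minimal_poly \<alpha> = - P"
proof -
  have "algebraic_point \<alpha>"
    using assms by (auto simp: algebraic_point_def is_minimal_poly_def)
  from minimal_poly_unique[OF minimal_poly_exists[OF this] assms] show ?thesis .
qed

lemma algebraic_pointsI: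
  assumes P: "is_minimal_poly P \<alpha>" and "degree P \<le> n" and Q: "\<And>i. of_int \<bar>coeff P i\<bar> \<le> Q"
  shows "\<alpha> \<in> algebraic_points n Q"
proof -
  have "poly_height P \<in> (\<lambda>j. \<bar>coeff P j\<bar>) ` {..degree P}"
    unfolding poly_height_def by (intro Max_in) auto
  hence "of_int (poly_height P) \<le> Q" using Q by auto
  moreover have "poly_height (minimal_poly \<alpha>) = poly_height P"
    using minimal_poly_cases[OF P] by (auto simp: poly_height_def)
  moreover have "degree (minimal_poly \<alpha>) \<le> n"
    using minimal_poly_cases[OF P] \<open>degree P \<le> n\<close> by auto
  ultimately show ?thesis
    using P by (auto simp: algebraic_points_def point_degree_def point_height_def
        algebraic_point_def is_minimal_poly_def)
qed

lemma is_minimal_poly_inject: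
  assumes "is_minimal_poly P \<alpha>" "is_minimal_poly M \<alpha>" and pos: "lead_coeff P > 0" "lead_coeff M > 0"
  shows "P = M"
  using minimal_poly_unique[OF assms(1,2)] pos by auto

lemma card_le_card_algebraic_points:
  assumes pos: "\<And>P. P \<in> Ps \<Longrightarrow> lead_coeff P > 0"
    and deg: "\<And>P. P \<in> Ps \<Longrightarrow> degree P \<le> n"
    and height: "\<And>P i. P \<in> Ps \<Longrightarrow> of_int \<bar>coeff P i\<bar> \<le> Q"
    and point: "\<And>P. P \<in> Ps \<Longrightarrow> \<exists>\<alpha>\<in>S. is_minimal_poly P \<alpha>"
  shows "card Ps \<le> card (algebraic_points n Q \<inter> S)"
proof -
  obtain \<alpha> where \<alpha>: "\<alpha> P \<in> S" "is_minimal_poly P (\<alpha> P)" if "P \<in> Ps" for P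
    using point by metis
  have "inj_on \<alpha> Ps"
  proof (rule inj_onI)
    fix P M assume "P \<in> Ps" "M \<in> Ps" "\<alpha> P = \<alpha> M"
    thus "P = M" using \<alpha>(2) pos is_minimal_poly_inject by metis
  qed
  moreover have "\<alpha> ` Ps \<subseteq> algebraic_points n Q \<inter> S"
    using \<alpha> deg height by (intro image_subsetI IntI algebraic_pointsI)
  ultimately show ?thesis
    by (rule card_inj_on_le) (simp add: finite_algebraic_points)
qed

section \<open>Pairs of integers without a common prime factor\<close>

lemma sum_inverse_squares_le:
  fixes F :: "int set"
  assumes "finite F" "k > 0" "F \<subseteq> {k<..}"
  shows "(\<Sum>i\<in>F. 1 / (real_of_int i)\<^sup>2) \<le> 1 / of_int k"
proof -
  have telescope: "(\<Sum>i\<in>{k<..M}. 1 / (real_of_int i)\<^sup>2) \<le> 1 / of_int k - 1 / of_int M"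
    if "k \<le> M" for M
    using that
  proof (induction M rule: int_ge_induct)
    case (step M)
    have "real_of_int M > 0" using step.hyps \<open>k > 0\<close> by simp
    hence "1 / (real_of_int (M + 1))\<^sup>2 \<le> 1 / of_int M - 1 / of_int (M + 1)"
      by (simp add: divide_simps power2_eq_square)
    moreover have "{k<..M + 1} = insert (M + 1) {k<..M}" using step.hyps by auto
    ultimately show ?case using step.IH by simp
  qed simp
  define M where "M = Max (insert k F)"
  have "k \<le> M" "F \<subseteq> {k<..M}" using assms by (auto simp: M_def)
  hence "(\<Sum>i\<in>F. 1 / (real_of_int i)\<^sup>2) \<le> (\<Sum>i\<in>{k<..M}. 1 / (real_of_int i)\<^sup>2)"
    by (intro sum_mono2) auto
  also have "\<dots> \<le> 1 / of_int k - 1 / of_int M" by (rule telescope) fact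
  also have "\<dots> \<le> 1 / of_int k" using \<open>k \<le> M\<close> \<open>k > 0\<close> by simp
  finally show ?thesis .
qed

lemma card_prime_factors_le_log:
  fixes q :: int
  assumes "q > 0"
  shows "real (card (prime_factors q)) \<le> log 2 (of_int q)"
proof -
  have "(2::int) ^ card (prime_factors q) = (\<Prod>p\<in>prime_factors q. 2)" by simp
  also have "\<dots> \<le> (\<Prod>p\<in>prime_factors q. p ^ multiplicity p q)"
  proof (rule prod_mono)
    fix p assume p: "p \<in> prime_factors q"
    have "2 \<le> p" using p by (auto simp: in_prime_factors_iff prime_ge_2_int)
    also have "p ^ 1 \<le> p ^ multiplicity p q"
      using p \<open>2 \<le> p\<close> by (intro power_increasing) (auto simp: prime_factors_multiplicity)
    finally show "0 \<le> (2::int) \<and> 2 \<le> p ^ multiplicity p q" by simp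
  qed
  also have "\<dots> = q" using assms prod_prime_factors[of q] by simp
  finally have "real_of_int (2 ^ card (prime_factors q)) \<le> of_int q" by (simp only: of_int_le_iff)
  thus ?thesis using assms by (simp add: le_log_iff powr_realpow)
qed

lemma coprime_gcd_iff_prime_factors:
  fixes s t q :: int
  assumes "q \<noteq> 0"
  shows "coprime (gcd s t) q \<longleftrightarrow> (\<forall>p\<in>prime_factors q. \<not> (p dvd s \<and> p dvd t))"
proof -
  have "coprime (gcd s t) q \<longleftrightarrow> (\<nexists>p. prime p \<and> p dvd gcd (gcd s t) q)"
    using assms prime_divisor_exists[of "gcd (gcd s t) q"] not_prime_unit
    by (metis dvd_trans gcd_eq_0_iff is_unit_gcd)
  thus ?thesis using assms by (auto simp: in_prime_factors_iff)
qed

lemma card_dvd_affine_le: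
  fixes a b p u0 :: int
  assumes p: "p > 0" and ap: "coprime a p"
  shows "real (card {u \<in> {u0..<u0 + int m}. p dvd a * u + b}) \<le> real m / of_int p + 1"
    (is "real (card ?S) \<le> _")
proof -
  let ?g = "\<lambda>u. (u - u0) div p"
  have "inj_on ?g ?S"
  proof (rule inj_onI)
    fix u v assume uv: "u \<in> ?S" "v \<in> ?S" and eq: "?g u = ?g v"
    have "p dvd (a * u + b) - (a * v + b)" using uv by (intro dvd_diff) auto
    also have "(a * u + b) - (a * v + b) = a * ((u - u0) - (v - u0))" by (simp add: algebra_simps)
    finally have "(u - u0) mod p = (v - u0) mod p"
      using ap by (simp add: mod_eq_dvd_iff coprime_dvd_mult_right_iff coprime_commute)
    with eq show "u = v" by (metis diff_add_cancel mult_div_mod_eq)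
  qed
  moreover have "?g ` ?S \<subseteq> {0..int m div p}"
    using p by (auto intro!: zdiv_mono1 simp: pos_imp_zdiv_nonneg_iff)
  ultimately have "card ?S \<le> card {0..int m div p}"
    by (rule card_inj_on_le) simp
  moreover have "0 \<le> int m div p" using p by (simp add: pos_imp_zdiv_nonneg_iff)
  ultimately have "real (card ?S) \<le> of_int (int m div p) + 1" by simp
  thus ?thesis using real_of_int_div4[of "int m" p] by simp
qed

lemma card_dvd_affine_pairs_le:
  fixes a b c d p u0 v0 :: int
  assumes p: "p > 0" and "coprime a p" "coprime c p"
  shows "real (card {(u, v) \<in> {u0..<u0 + int m} \<times> {v0..<v0 + int m}.
      p dvd a * u + b \<and> p dvd c * v + d})
    \<le> (real m)\<^sup>2 * (1 / (of_int p)\<^sup>2) + 3 * real m"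
    (is "real (card ?S) \<le> _")
proof (cases "m = 0")
  case False
  let ?t = "real m / of_int p"
  have "?S = {u \<in> {u0..<u0 + int m}. p dvd a * u + b} \<times> {v \<in> {v0..<v0 + int m}. p dvd c * v + d}"
    by auto
  hence "real (card ?S) \<le> (?t + 1) * (?t + 1)"
    using assms
    by (simp only: card_cartesian_product of_nat_mult) (intro mult_mono card_dvd_affine_le; simp)
  also have "\<dots> = (real m)\<^sup>2 * (1 / (of_int p)\<^sup>2) + (2 * ?t + 1)"
    by (simp add: power2_eq_square algebra_simps)
  also have "?t \<le> real m / 1" using p by (intro divide_left_mono) auto
  finally show ?thesis using False by simp
qed simp

lemma card_coprime_affine_pairs_ge:
  fixes a b c d q u0 v0 :: int
  assumes q: "q > 0" "odd q" and ac: "coprime a q" "coprime c q"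
    and m: "12 * log 2 (of_int q) \<le> real m"
  shows "(real m)\<^sup>2 / 4 \<le> real (card {(u, v) \<in> {u0..<u0 + int m} \<times> {v0..<v0 + int m}.
           coprime (gcd (a * u + b) (c * v + d)) q})"
    (is "_ \<le> real (card ?G)")
proof -
  let ?R = "{u0..<u0 + int m} \<times> {v0..<v0 + int m}" and ?F = "prime_factors q"
  let ?D = "\<lambda>p. {(u, v) \<in> ?R. p dvd a * u + b \<and> p dvd c * v + d}"
  have prime_factor: "p > 2" "coprime a p" "coprime c p" if "p \<in> ?F" for p
  proof -
    have p: "prime p" "p dvd q" using that by (auto simp: in_prime_factors_iff)
    hence "p \<noteq> 2" using \<open>odd q\<close> by auto
    thus "p > 2" using prime_ge_2_int[OF p(1)] by linarith
    show "coprime a p" "coprime c p" using ac coprime_divisors[OF dvd_refl p(2)] by blast+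
  qed
  have "?R \<subseteq> ?G \<union> (\<Union>p\<in>?F. ?D p)"
    using q(1) by (auto simp: coprime_gcd_iff_prime_factors)
  moreover have "finite ?G" "\<And>p. finite (?D p)"
    by (rule finite_subset[of _ ?R]; auto)+
  ultimately have "card ?R \<le> card (?G \<union> (\<Union>p\<in>?F. ?D p))"
    by (intro card_mono finite_UnI finite_UN_I finite_set_mset)
  also have "\<dots> \<le> card ?G + card (\<Union>p\<in>?F. ?D p)" by (rule card_Un_le)
  finally have "card ?R \<le> card ?G + (\<Sum>p\<in>?F. card (?D p))"
    using card_UN_le[OF finite_set_mset, of ?D "prime_factorization q"] by linarith
  hence "real (card ?R) \<le> real (card ?G) + (\<Sum>p\<in>?F. real (card (?D p)))"
    unfolding of_nat_sum[symmetric] of_nat_add[symmetric] of_nat_le_iff .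
  hence total: "(real m)\<^sup>2 \<le> real (card ?G) + (\<Sum>p\<in>?F. real (card (?D p)))"
    by (simp add: power2_eq_square card_cartesian_product)
  have "(\<Sum>p\<in>?F. real (card (?D p))) \<le> (\<Sum>p\<in>?F. (real m)\<^sup>2 * (1 / (of_int p)\<^sup>2) + 3 * real m)"
    using prime_factor by (intro sum_mono card_dvd_affine_pairs_le) force+
  also have "\<dots> = (real m)\<^sup>2 * (\<Sum>p\<in>?F. 1 / (of_int p)\<^sup>2) + 3 * real m * real (card ?F)"
    by (simp add: sum.distrib sum_distrib_left)
  also have "\<dots> \<le> (real m)\<^sup>2 * (1 / of_int 2) + 3 * real m * (real m / 12)"
  proof (intro add_mono mult_left_mono)
    show "(\<Sum>p\<in>?F. 1 / (real_of_int p)\<^sup>2) \<le> 1 / of_int 2"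
      using prime_factor by (intro sum_inverse_squares_le) auto
    show "real (card ?F) \<le> real m / 12"
      using card_prime_factors_le_log[OF q(1)] m by linarith
  qed simp_all
  finally show ?thesis using total by (simp add: power2_eq_square)
qed

section \<open>Zeros of a perturbed quadratic polynomial\<close>

lemma ex_zero_in_ball:
  fixes h h' :: "real \<Rightarrow> real"
  assumes deriv: "\<And>t. t \<in> cball x r \<Longrightarrow> (h has_real_derivative h' t) (at t)"
    and near: "\<And>t. t \<in> cball x r \<Longrightarrow> \<bar>h' t - s\<bar> \<le> e"
    and small: "\<bar>h x\<bar> < (\<bar>s\<bar> - e) * r" and r: "r > 0"
  shows "\<exists>z\<in>ball x r. h z = 0"
proof -
  have near_linear: "\<bar>(h t - s * t) - (h x - s * x)\<bar> \<le> e * \<bar>t - x\<bar>" if "t \<in> cball x r" for t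
  proof -
    have "norm ((h t - s * t) - (h x - s * x)) \<le> e * norm (t - x)"
    proof (rule field_differentiable_bound[where S = "cball x r" and f' = "\<lambda>t. h' t - s"])
      show "((\<lambda>t. h t - s * t) has_field_derivative h' t - s) (at t within cball x r)"
        if "t \<in> cball x r" for t
        using DERIV_diff[OF deriv[OF that] DERIV_cmult_Id[of s]]
        by (rule has_field_derivative_at_within)
    qed (use near r that in auto)
    thus ?thesis by simp
  qed
  have "\<bar>h (x + r) - h x - s * r\<bar> \<le> e * r" "\<bar>h (x - r) - h x + s * r\<bar> \<le> e * r"
    using near_linear[of "x + r"] near_linear[of "x - r"] r
    by (auto simp: dist_real_def algebra_simps)
  moreover have "\<bar>h x\<bar> + e * r < \<bar>s\<bar> * r" using small by (simp add: algebra_simps)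
  moreover have "s * r = \<bar>s\<bar> * r \<or> s * r = - (\<bar>s\<bar> * r)" by (auto simp: abs_if)
  ultimately have sign_change: "h (x - r) < 0 \<and> 0 < h (x + r) \<or> h (x + r) < 0 \<and> 0 < h (x - r)"
    by linarith
  have "continuous_on {x - r..x + r} h"
    using deriv[THEN DERIV_isCont]
    by (intro continuous_at_imp_continuous_on) (auto simp: dist_real_def)
  then obtain z where z: "x - r \<le> z" "z \<le> x + r" "h z = 0"
    using sign_change r IVT'[of h "x - r" 0 "x + r"] IVT2'[of h "x + r" 0 "x - r"] by force
  moreover have "z \<noteq> x - r" "z \<noteq> x + r" using z(3) sign_change by auto
  ultimately show ?thesis by (intro bexI[of _ z]) (auto simp: dist_real_def)
qed

definition quadratic_tail :: "'a :: comm_ring_1 poly \<Rightarrow> 'a poly" where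
  "quadratic_tail p = p - [:coeff p 0, coeff p 1, coeff p 2:]"

lemma poly_conv_quadratic_tail:
  "poly p t = coeff p 0 + coeff p 1 * t + coeff p 2 * t\<^sup>2 + poly (quadratic_tail p) t"
  by (simp add: quadratic_tail_def power2_eq_square algebra_simps)

lemma poly_pderiv_conv_quadratic_tail:
  fixes p :: "'a :: idom poly"
  shows "poly (pderiv p) t = coeff p 1 + 2 * coeff p 2 * t + poly (pderiv (quadratic_tail p)) t"
  by (simp add: quadratic_tail_def pderiv_diff pderiv_pCons algebra_simps)

lemma coeff_quadratic_tail: "coeff (quadratic_tail p) i = (if i \<le> 2 then 0 else coeff p i)"
  by (auto simp: quadratic_tail_def coeff_pCons numeral_2_eq_2 split: nat.splits)

lemma norm_poly_le:
  fixes q :: "'a :: real_normed_field poly"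
  assumes "degree q \<le> n" "\<And>i. norm (coeff q i) \<le> h" "norm t \<le> X" "1 \<le> X"
  shows "norm (poly q t) \<le> real (Suc n) * (h * X ^ n)"
proof -
  have "0 \<le> h" using assms(2)[of 0] norm_ge_zero order_trans by blast
  have "poly q t = (\<Sum>i\<le>n. coeff q i * t ^ i)"
    unfolding poly_altdef using assms(1) by (intro sum.mono_neutral_left) (auto simp: coeff_eq_0)
  also have "norm \<dots> \<le> (\<Sum>i\<le>n. h * X ^ n)"
  proof (rule sum_norm_le)
    fix i assume "i \<in> {..n}"
    have "norm t ^ i \<le> X ^ i" using assms(3) by (intro power_mono) auto
    also have "\<dots> \<le> X ^ n" using \<open>i \<in> _\<close> assms(4) by (intro power_increasing) auto
    finally show "norm (coeff q i * t ^ i) \<le> h * X ^ n"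
      unfolding norm_mult norm_power using assms(2) \<open>0 \<le> h\<close> by (intro mult_mono) auto
  qed
  finally show ?thesis by simp
qed

lemma norm_poly_pderiv_le:
  fixes q :: "'a :: real_normed_field poly"
  assumes "degree q \<le> Suc n" "\<And>i. norm (coeff q i) \<le> h" "norm t \<le> X" "1 \<le> X"
  shows "norm (poly (pderiv q) t) \<le> (real (Suc n))\<^sup>2 * h * X ^ n"
proof -
  have "0 \<le> h" using assms(2)[of 0] norm_ge_zero order_trans by blast
  have "norm (coeff (pderiv q) i) \<le> real (Suc n) * h" for i
  proof (cases "i \<le> n")
    case True
    thus ?thesis unfolding coeff_pderiv norm_mult norm_of_nat
      using assms(2) \<open>0 \<le> h\<close> by (intro mult_mono) auto
  next
    case False
    thus ?thesis using assms(1) \<open>0 \<le> h\<close> by (simp add: coeff_pderiv coeff_eq_0)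
  qed
  moreover have "degree (pderiv q) \<le> n"
    using assms(1) by (intro degree_le) (simp add: coeff_pderiv coeff_eq_0)
  ultimately have "norm (poly (pderiv q) t) \<le> real (Suc n) * (real (Suc n) * h * X ^ n)"
    using assms(3,4) by (intro norm_poly_le)
  thus ?thesis by (simp only: power2_eq_square mult.assoc)
qed

locale off_diagonal_square =
  fixes X d r x y :: real
  assumes r: "0 < r" "r \<le> d / 8" and gap: "d \<le> \<bar>x - y\<bar>"
    and x: "\<bar>x\<bar> + r \<le> X" and y: "\<bar>y\<bar> + r \<le> X"
begin

lemma d_pos: "d > 0" and d_le: "d \<le> 2 * X"
  using r gap x y by linarith+

lemma off_diagonal_square_swap: "off_diagonal_square X d r y x"
  using r gap x y by (simp add: off_diagonal_square_def abs_minus_commute)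

end

text \<open>With \<open>c = coeff p 2\<close>, such a \<open>p\<close> is close to \<open>c (t - x) (t - y)\<close>, hence its derivative is
  close to \<open>c (x - y)\<close> near \<open>x\<close> and to \<open>c (y - x)\<close> near \<open>y\<close>.\<close>
locale dominant_quadratic = off_diagonal_square X d r x y for X d r x y :: real +
  fixes p :: "real poly"
  assumes coeff_2_nonzero: "coeff p 2 \<noteq> 0"
    and tail: "\<And>t. \<bar>t\<bar> \<le> X \<Longrightarrow> \<bar>poly (pderiv (quadratic_tail p)) t\<bar> \<le> \<bar>coeff p 2\<bar> * d / 8"
    and small_x: "\<bar>poly p x\<bar> \<le> \<bar>coeff p 2\<bar> * d * r / 8"
    and small_y: "\<bar>poly p y\<bar> \<le> \<bar>coeff p 2\<bar> * d * r / 8"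
begin

lemma abs_quadratic_tail_diff_le:
  assumes "\<bar>s\<bar> \<le> X" "\<bar>t\<bar> \<le> X"
  shows "\<bar>poly (quadratic_tail p) t - poly (quadratic_tail p) s\<bar> \<le> \<bar>coeff p 2\<bar> * d / 8 * \<bar>t - s\<bar>"
proof -
  have "norm (poly (quadratic_tail p) t - poly (quadratic_tail p) s)
      \<le> \<bar>coeff p 2\<bar> * d / 8 * norm (t - s)"
    by (rule field_differentiable_bound[where S = "{-X..X}"])
      (use tail assms in \<open>auto intro: has_field_derivative_at_within[OF poly_DERIV]\<close>)
  thus ?thesis by simp
qed

lemma abs_linear_coeff_near: "\<bar>coeff p 1 + coeff p 2 * (x + y)\<bar> \<le> 5 / 32 * (\<bar>coeff p 2\<bar> * d)"
proof -
  let ?c = "\<bar>coeff p 2\<bar>" and ?T = "poly (quadratic_tail p)"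
  have "\<bar>x - y\<bar> * \<bar>coeff p 1 + coeff p 2 * (x + y)\<bar> = \<bar>(poly p x - poly p y) - (?T x - ?T y)\<bar>"
    unfolding poly_conv_quadratic_tail[of p] abs_mult[symmetric]
    by (simp add: algebra_simps power2_eq_square)
  also have "\<dots> \<le> \<bar>poly p x\<bar> + \<bar>poly p y\<bar> + \<bar>?T x - ?T y\<bar>" by linarith
  also have "\<dots> \<le> ?c * d * r / 8 + ?c * d * r / 8 + ?c * d / 8 * \<bar>x - y\<bar>"
    using abs_quadratic_tail_diff_le[of y x] x y r by (intro add_mono small_x small_y) auto
  also have "\<dots> \<le> ?c * d * (\<bar>x - y\<bar> / 8) / 8 + ?c * d * (\<bar>x - y\<bar> / 8) / 8 + ?c * d / 8 * \<bar>x - y\<bar>"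
    using r gap d_pos by (intro add_mono divide_right_mono mult_left_mono) auto
  also have "\<dots> = \<bar>x - y\<bar> * (5 / 32 * (?c * d))" by simp
  finally show ?thesis using gap d_pos by (subst (asm) mult_le_cancel_left_pos) auto
qed

lemma ex_zero: "\<exists>z\<in>ball x r. poly p z = 0"
proof (rule ex_zero_in_ball[OF poly_DERIV])
  let ?c = "\<bar>coeff p 2\<bar>"
  have dominance: "?c * d \<le> ?c * \<bar>x - y\<bar>" using gap by (intro mult_left_mono) auto
  have "?c * d / 8 * r < 15 / 32 * (?c * d) * r" using coeff_2_nonzero d_pos r by simp
  also have "\<dots> \<le> (\<bar>coeff p 2 * (x - y)\<bar> - 17 / 32 * (?c * d)) * r"
    using dominance r by (intro mult_right_mono) (auto simp: abs_mult mult.commute)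
  finally show "\<bar>poly p x\<bar> < (\<bar>coeff p 2 * (x - y)\<bar> - 17 / 32 * (?c * d)) * r"
    using small_x by simp
  fix t assume t: "t \<in> cball x r"
  have "\<bar>2 * coeff p 2 * (t - x)\<bar> \<le> 2 * ?c * (d / 8)"
    unfolding abs_mult using t r by (intro mult_mono) (auto simp: dist_real_def abs_minus_commute)
  moreover have "\<bar>poly (pderiv (quadratic_tail p)) t\<bar> \<le> ?c * d / 8"
    using t x by (intro tail) (auto simp: dist_real_def)
  moreover have "poly (pderiv p) t - coeff p 2 * (x - y) = (coeff p 1 + coeff p 2 * (x + y))
      + 2 * coeff p 2 * (t - x) + poly (pderiv (quadratic_tail p)) t"
    by (simp add: poly_pderiv_conv_quadratic_tail[of p] algebra_simps)
  ultimately show "\<bar>poly (pderiv p) t - coeff p 2 * (x - y)\<bar> \<le> 17 / 32 * (?c * d)"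
    using abs_linear_coeff_near by linarith
qed (rule r)

lemma dominant_quadratic_swap: "dominant_quadratic X d r y x p"
  using off_diagonal_square_swap coeff_2_nonzero tail small_y small_x
  unfolding dominant_quadratic_def dominant_quadratic_axioms_def by blast

lemma abs_coeff_1_le: "\<bar>coeff p 1\<bar> \<le> 3 * (\<bar>coeff p 2\<bar> * X)"
proof -
  have "\<bar>coeff p 2 * (x + y)\<bar> \<le> \<bar>coeff p 2\<bar> * (2 * X)" "\<bar>coeff p 2\<bar> * d \<le> \<bar>coeff p 2\<bar> * (2 * X)"
    using x y r d_le by (auto simp: abs_mult intro!: mult_left_mono)
  thus ?thesis using abs_linear_coeff_near by linarith
qed

lemma abs_coeff_0_le: "\<bar>coeff p 0\<bar> \<le> 5 * (\<bar>coeff p 2\<bar> * X\<^sup>2)"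
proof -
  let ?c = "\<bar>coeff p 2\<bar>" and ?T = "poly (quadratic_tail p)"
  have box: "\<bar>x\<bar> \<le> X" "0 \<le> X" "r \<le> X" "d \<le> 2 * X" using x r d_le by auto
  have "?c * d * r / 8 \<le> ?c * (2 * X) * X / 8"
    using box d_pos r by (intro divide_right_mono mult_mono) auto
  hence "\<bar>poly p x\<bar> \<le> ?c * (2 * X) * X / 8" using small_x by linarith
  hence "\<bar>poly p x\<bar> \<le> ?c * X\<^sup>2 / 4" by (simp add: power2_eq_square mult_ac)
  moreover have "\<bar>?T x\<bar> \<le> ?c * X\<^sup>2 / 4"
  proof -
    have "?T 0 = 0" by (simp add: quadratic_tail_def poly_0_coeff_0)
    hence "\<bar>?T x\<bar> \<le> ?c * d / 8 * \<bar>x\<bar>"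
      using abs_quadratic_tail_diff_le[of 0 x] box by simp
    also have "\<dots> \<le> ?c * (2 * X) / 8 * X"
      using box d_pos by (intro mult_mono divide_right_mono) auto
    finally show ?thesis by (simp add: power2_eq_square mult_ac)
  qed
  moreover have "\<bar>coeff p 1 * x\<bar> \<le> 3 * (?c * X\<^sup>2)"
  proof -
    have "\<bar>coeff p 1 * x\<bar> \<le> 3 * (?c * X) * X"
      unfolding abs_mult using box abs_coeff_1_le by (intro mult_mono) auto
    thus ?thesis by (simp add: power2_eq_square)
  qed
  moreover have "\<bar>coeff p 2 * x\<^sup>2\<bar> \<le> ?c * X\<^sup>2"
    using box by (auto simp: abs_mult abs_le_square_iff[symmetric] intro!: mult_left_mono)
  moreover have "coeff p 0 = poly p x - coeff p 1 * x - coeff p 2 * x\<^sup>2 - ?T x"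
    by (simp add: poly_conv_quadratic_tail[of p])
  moreover have "0 \<le> ?c * X\<^sup>2" by simp
  ultimately show ?thesis by linarith
qed

lemma abs_coeff_le:
  assumes "1 \<le> X" "i \<le> 2"
  shows "\<bar>coeff p i\<bar> \<le> 5 * (\<bar>coeff p 2\<bar> * X\<^sup>2)"
proof -
  have "1 \<le> X\<^sup>2" "X \<le> X\<^sup>2" using assms(1) by (simp_all add: self_le_power)
  from this[THEN mult_left_mono, of "\<bar>coeff p 2\<bar>"]
  have "\<bar>coeff p 2\<bar> \<le> \<bar>coeff p 2\<bar> * X\<^sup>2" "\<bar>coeff p 2\<bar> * X \<le> \<bar>coeff p 2\<bar> * X\<^sup>2"
    by simp_all
  hence "\<bar>coeff p 1\<bar> \<le> 5 * (\<bar>coeff p 2\<bar> * X\<^sup>2)" "\<bar>coeff p 2\<bar> \<le> 5 * (\<bar>coeff p 2\<bar> * X\<^sup>2)"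
    using abs_coeff_1_le by linarith+
  moreover have "i \<in> {0, 1, 2}" using assms(2) by auto
  ultimately show ?thesis using abs_coeff_0_le by (elim insertE emptyE) (simp_all only:)
qed

end

section \<open>Points in a small square\<close>

text \<open>The constant coefficient of an upper polynomial \<open>W\<close> becomes the coefficient of \<open>t\<^sup>2\<close> in
  \<open>eisenstein_poly W u v\<close>, where it has to dominate the higher ones. The parities are those required
  by Eisenstein's criterion at 2.\<close>
definition upper_polys :: "nat \<Rightarrow> nat \<Rightarrow> nat \<Rightarrow> int poly set" where
  "upper_polys k B N = polys_with_coeffs_in k
     (\<lambda>i. (\<lambda>j. 2 * j + of_bool (i = k)) ` (if i = 0 then {int B..<2 * int B} else {0..<int N}))"

definition eisenstein_poly :: "int poly \<Rightarrow> int \<Rightarrow> int \<Rightarrow> int poly" where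
  "eisenstein_poly W u v = pCons (4 * v + 2) (pCons (2 * u) W)"

lemma finite_upper_polys: "finite (upper_polys k B N)"
  unfolding upper_polys_def by (intro finite_polys_with_coeffs_in finite_imageI) auto

lemma card_upper_polys: "card (upper_polys k B N) = B * N ^ k"
proof -
  have "card ((\<lambda>j. 2 * j + of_bool (i = k)) ` (if i = 0 then {int B..<2 * int B} else {0..<int N}))
      = (if i = 0 then B else N)" for i
    by (subst card_image) (auto intro: inj_onI)
  hence "card (upper_polys k B N) = (\<Prod>i\<le>k. if i = 0 then B else N)"
    by (simp add: upper_polys_def card_polys_with_coeffs_in)
  thus ?thesis by (simp add: prod.atMost_shift)
qed

lemma coeff_upper_polys:
  assumes "W \<in> upper_polys k B N" "i \<le> k"
  shows "coeff W i \<in>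
    (\<lambda>j. 2 * j + of_bool (i = k)) ` (if i = 0 then {int B..<2 * int B} else {0..<int N})"
  using assms by (simp add: upper_polys_def polys_with_coeffs_in_def)

lemma odd_coeff_upper_polys_iff:
  assumes "W \<in> upper_polys k B N" "i \<le> k"
  shows "odd (coeff W i) \<longleftrightarrow> i = k"
  using coeff_upper_polys[OF assms] by auto

lemma coeff_0_upper_polys:
  assumes "W \<in> upper_polys k B N"
  shows "coeff W 0 \<in> {2 * int B..<4 * int B}"
  using coeff_upper_polys[OF assms, of 0] by auto

lemma higher_coeff_upper_polys:
  assumes W: "W \<in> upper_polys k B N" and "i > 0"
  shows "coeff W i \<in> {0..2 * int N}"
proof (cases "i \<le> k")
  case True
  thus ?thesis using coeff_upper_polys[OF W True] \<open>i > 0\<close> by auto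
next
  case False
  hence "coeff W i = 0"
    using W by (intro coeff_eq_0) (simp add: upper_polys_def polys_with_coeffs_in_def)
  thus ?thesis by simp
qed

lemma degree_upper_polys:
  assumes W: "W \<in> upper_polys k B N"
  shows "degree W = k"
proof (rule antisym)
  show "degree W \<le> k" using W by (simp add: upper_polys_def polys_with_coeffs_in_def)
  have "coeff W k \<noteq> 0" using odd_coeff_upper_polys_iff[OF W order_refl] by auto
  thus "k \<le> degree W" by (rule le_degree)
qed

lemma lead_coeff_upper_polys:
  assumes W: "W \<in> upper_polys k B N" and "N \<le> B"
  shows "0 < lead_coeff W" "lead_coeff W \<le> 4 * int B" "odd (lead_coeff W)"
proof -
  show "odd (lead_coeff W)"
    using odd_coeff_upper_polys_iff[OF W order_refl] by (simp add: degree_upper_polys[OF W])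
  hence "lead_coeff W \<noteq> 0" by auto
  moreover have "0 \<le> lead_coeff W" "lead_coeff W \<le> 4 * int B"
    using coeff_0_upper_polys[OF W] higher_coeff_upper_polys[OF W, of "degree W"] \<open>N \<le> B\<close>
    by (cases "degree W = 0"; simp)+
  ultimately show "0 < lead_coeff W" "lead_coeff W \<le> 4 * int B" by linarith+
qed

lemma coeff_eisenstein_poly:
  "coeff (eisenstein_poly W u v) i =
    (if i = 0 then 4 * v + 2 else if i = 1 then 2 * u else coeff W (i - 2))"
  by (auto simp: eisenstein_poly_def coeff_pCons numeral_2_eq_2 split: nat.splits)

lemma degree_eisenstein_poly: "W \<noteq> 0 \<Longrightarrow> degree (eisenstein_poly W u v) = degree W + 2"
  by (simp add: eisenstein_poly_def)

lemma eisenstein_eisenstein_poly: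
  assumes W: "W \<in> upper_polys k B N"
  shows "eisenstein 2 (eisenstein_poly W u v)"
proof -
  have "W \<noteq> 0" using odd_coeff_upper_polys_iff[OF W order_refl] by auto
  hence "degree (eisenstein_poly W u v) = k + 2"
    by (simp add: degree_eisenstein_poly degree_upper_polys[OF W])
  moreover have "even (coeff W i)" if "i < k" for i
    using odd_coeff_upper_polys_iff[OF W, of i] that by simp
  moreover have "\<not> 4 dvd 4 * v + 2" by presburger
  ultimately show ?thesis
    using odd_coeff_upper_polys_iff[OF W order_refl]
    by (auto simp: eisenstein_def coeff_eisenstein_poly)
qed

lemma card_coprime_window_ge:
  assumes W: "W \<in> upper_polys k B N" and "N \<le> B" and log: "12 * log 2 (4 * real B) \<le> real m"
  shows "(real m)\<^sup>2 / 4 \<le> real (card {(u, v) \<in> {u0..<u0 + int m} \<times> {v0..<v0 + int m}.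
    coprime (gcd (2 * u) (4 * v + 2)) (lead_coeff W)})"
proof (rule card_coprime_affine_pairs_ge[where b = 0, simplified add_0_right])
  note lead = lead_coeff_upper_polys[OF W \<open>N \<le> B\<close>]
  show "lead_coeff W > 0" "odd (lead_coeff W)" "coprime 2 (lead_coeff W)" "coprime 4 (lead_coeff W)"
    using lead coprime_power_left_iff[of 2 2 "lead_coeff W"] by auto
  have "real_of_int (lead_coeff W) \<le> 4 * real B" using lead(2) by linarith
  hence "log 2 (of_int (lead_coeff W)) \<le> log 2 (4 * real B)" using lead(1) by simp
  thus "12 * log 2 (of_int (lead_coeff W)) \<le> real m" using log by linarith
qed

lemma abs_mult_diff_ceiling_le:
  fixes c k :: real
  assumes "k > 0" "u \<in> {\<lceil>c / k\<rceil>..<\<lceil>c / k\<rceil> + int m}"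
  shows "\<bar>k * of_int u - c\<bar> \<le> k * real m"
proof -
  have "c / k \<le> of_int u" "of_int u \<le> c / k + real m"
    using assms(2) by (auto simp: ceiling_le_iff) linarith
  thus ?thesis using assms(1) by (auto simp: field_simps abs_le_iff)
qed

lemma ex_small_value_window:
  fixes W :: "int poly" and x y :: real and m :: nat
  assumes "x \<noteq> y"
  shows "\<exists>u0 v0. \<forall>u\<in>{u0..<u0 + int m}. \<forall>v\<in>{v0..<v0 + int m}. \<forall>t\<in>{x, y}.
    \<bar>poly (real_poly (eisenstein_poly W u v)) t\<bar> \<le> 2 * real m * \<bar>t\<bar> + 4 * real m"
proof -
  define g where "g = (\<lambda>t. t\<^sup>2 * poly (real_poly W) t)"
  define s where "s = (g y - g x) / (y - x)"
  define k where "k = g x - s * x"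
  have "s * (y - x) = g y - g x" using assms by (simp add: s_def)
  hence chord: "g t = s * t + k" if "t \<in> {x, y}" for t
    using that by (auto simp: k_def algebra_simps)
  have "\<bar>poly (real_poly (eisenstein_poly W u v)) t\<bar> \<le> 2 * real m * \<bar>t\<bar> + 4 * real m"
    if u: "u \<in> {\<lceil>- s / 2\<rceil>..<\<lceil>- s / 2\<rceil> + int m}"
      and v: "v \<in> {\<lceil>(- k - 2) / 4\<rceil>..<\<lceil>(- k - 2) / 4\<rceil> + int m}" and t: "t \<in> {x, y}" for u v t
  proof -
    have "poly (real_poly (eisenstein_poly W u v)) t
        = (2 * of_int u - - s) * t + (4 * of_int v - (- k - 2))"
      using chord[OF t]
      by (simp add: eisenstein_poly_def map_poly_pCons g_def power2_eq_square algebra_simps)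
    also have "\<bar>\<dots>\<bar> \<le> \<bar>2 * of_int u - - s\<bar> * \<bar>t\<bar> + \<bar>4 * of_int v - (- k - 2)\<bar>"
      unfolding abs_mult[symmetric] by (rule abs_triangle_ineq)
    also have "\<dots> \<le> 2 * real m * \<bar>t\<bar> + 4 * real m"
      using abs_mult_diff_ceiling_le[OF _ u] abs_mult_diff_ceiling_le[OF _ v]
      by (intro add_mono mult_right_mono) auto
    finally show ?thesis .
  qed
  thus ?thesis by blast
qed

text \<open>The bounds \<open>B\<close>, \<open>N\<close> and \<open>m\<close> give the size of the coefficient of \<open>t\<^sup>2\<close>, the size of the higher
  coefficients and the length of the ranges of \<open>u\<close> and \<open>v\<close>.\<close>
locale square_parameters = off_diagonal_square X d r x y for X d r x y :: real +
  fixes n B N m :: nat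
  assumes n: "n \<ge> 2" and X: "X \<ge> 1" and B: "B \<ge> 1" and N: "N \<le> B"
    and upper_small: "8 * (real n)\<^sup>2 * real N * X ^ (n - 1) \<le> real B * d"
    and lower_small: "24 * real m * X \<le> real B * d * r"
begin

context
  fixes W :: "int poly" and u v :: int
  assumes W: "W \<in> upper_polys (n - 2) B N"
    and values_small: "\<And>t. t \<in> {x, y} \<Longrightarrow>
      \<bar>poly (real_poly (eisenstein_poly W u v)) t\<bar> \<le> 2 * real m * \<bar>t\<bar> + 4 * real m"
begin

lemma degree_eisenstein_poly_eq: "degree (eisenstein_poly W u v) = n"
proof -
  have "W \<noteq> 0" using lead_coeff_upper_polys(1)[OF W N] by auto
  thus ?thesis using n by (simp add: degree_eisenstein_poly degree_upper_polys[OF W])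
qed

lemma dominant_quadratic_eisenstein_poly:
  "dominant_quadratic X d r x y (real_poly (eisenstein_poly W u v))"
proof
  let ?p = "real_poly (eisenstein_poly W u v)"
  have coeff_2_ge: "2 * real B \<le> \<bar>coeff ?p 2\<bar>"
    using coeff_0_upper_polys[OF W] by (simp add: coeff_map_poly coeff_eisenstein_poly)
  show "coeff ?p 2 \<noteq> 0" using coeff_2_ge B by auto
  have value_le: "\<bar>poly ?p t\<bar> \<le> \<bar>coeff ?p 2\<bar> * d * r / 8" if t: "t \<in> {x, y}" "\<bar>t\<bar> \<le> X" for t
  proof -
    have "2 * real m * \<bar>t\<bar> \<le> 2 * real m * X" "4 * real m * 1 \<le> 4 * real m * X"
      using t(2) X by (intro mult_left_mono; simp)+
    hence "\<bar>poly ?p t\<bar> \<le> 6 * (real m * X)" using values_small[OF t(1)] by linarith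
    also have "\<dots> \<le> 2 * real B * d * r / 8" using lower_small by (simp add: mult_ac)
    also have "\<dots> \<le> \<bar>coeff ?p 2\<bar> * d * r / 8"
      using coeff_2_ge d_pos r by (intro divide_right_mono mult_right_mono) auto
    finally show ?thesis .
  qed
  show "\<bar>poly ?p x\<bar> \<le> \<bar>coeff ?p 2\<bar> * d * r / 8" using x r by (intro value_le) auto
  show "\<bar>poly ?p y\<bar> \<le> \<bar>coeff ?p 2\<bar> * d * r / 8" using y r by (intro value_le) auto
  fix t :: real assume t: "\<bar>t\<bar> \<le> X"
  have "norm (poly (pderiv (quadratic_tail ?p)) t)
      \<le> (real (Suc (n - 1)))\<^sup>2 * (2 * real N) * X ^ (n - 1)"
  proof (rule norm_poly_pderiv_le)
    show "degree (quadratic_tail ?p) \<le> Suc (n - 1)"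
      using n degree_eisenstein_poly_eq
      by (intro degree_le) (auto simp: coeff_quadratic_tail coeff_map_poly coeff_eq_0)
    show "norm (coeff (quadratic_tail ?p) i) \<le> 2 * real N" for i
      using higher_coeff_upper_polys[OF W, of "i - 2"]
      by (cases "i \<le> 2") (simp_all add: coeff_quadratic_tail coeff_map_poly coeff_eisenstein_poly)
  qed (use t X in auto)
  also have "\<dots> \<le> 2 * real B * d / 8" using upper_small n by (simp add: mult_ac)
  also have "\<dots> \<le> \<bar>coeff ?p 2\<bar> * d / 8"
    using coeff_2_ge d_pos by (intro divide_right_mono mult_right_mono) auto
  finally show "\<bar>poly (pderiv (quadratic_tail ?p)) t\<bar> \<le> \<bar>coeff ?p 2\<bar> * d / 8" by simp
qed

lemma ex_minimal_poly_eisenstein_poly: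
  assumes coprime: "coprime (gcd (2 * u) (4 * v + 2)) (lead_coeff W)"
  shows "\<exists>\<alpha>\<in>ball x r \<times> ball y r. is_minimal_poly (eisenstein_poly W u v) \<alpha>"
proof -
  let ?P = "eisenstein_poly W u v"
  interpret dominant_quadratic X d r x y "real_poly ?P"
    by (rule dominant_quadratic_eisenstein_poly)
  interpret swap: dominant_quadratic X d r y x "real_poly ?P"
    by (rule dominant_quadratic_swap)
  obtain z1 z2 where z: "z1 \<in> ball x r" "z2 \<in> ball y r" "vanishes_at ?P (z1, z2)"
    using ex_zero swap.ex_zero by (auto simp: vanishes_at_def)
  have "content ?P = 1"
    using coprime
    by (intro content_eq_1I[of _ 1 0 "degree W + 2"]) (simp add: coeff_eisenstein_poly)
  hence "is_minimal_poly ?P (z1, z2)"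
    using eisenstein_eisenstein_poly[OF W] z(3) by (intro is_minimal_poly_eisenstein[of 2]) auto
  thus ?thesis using z(1,2) by (intro bexI[of _ "(z1, z2)"]) auto
qed

lemma abs_coeff_eisenstein_poly_le:
  "of_int \<bar>coeff (eisenstein_poly W u v) i\<bar> \<le> 20 * X\<^sup>2 * real B"
proof -
  let ?p = "real_poly (eisenstein_poly W u v)"
  interpret dominant_quadratic X d r x y ?p
    by (rule dominant_quadratic_eisenstein_poly)
  have coeff_2_le: "\<bar>coeff ?p 2\<bar> \<le> 4 * real B"
    using coeff_0_upper_polys[OF W] by (simp add: coeff_map_poly coeff_eisenstein_poly)
  have "\<bar>coeff ?p i\<bar> \<le> 5 * (4 * real B * X\<^sup>2)"
  proof (cases "i \<le> 2")
    case True
    have "\<bar>coeff ?p i\<bar> \<le> 5 * (\<bar>coeff ?p 2\<bar> * X\<^sup>2)" by (rule abs_coeff_le) (use X True in auto)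
    also have "\<dots> \<le> 5 * (4 * real B * X\<^sup>2)"
      using coeff_2_le by (intro mult_left_mono mult_right_mono) auto
    finally show ?thesis .
  next
    case False
    hence "\<bar>coeff ?p i\<bar> \<le> 2 * real B * 1"
      using higher_coeff_upper_polys[OF W, of "i - 2"] N
      by (simp add: coeff_map_poly coeff_eisenstein_poly)
    also have "\<dots> \<le> 20 * real B * X\<^sup>2" using X by (intro mult_mono) auto
    finally show ?thesis by simp
  qed
  thus ?thesis by (simp add: coeff_map_poly mult_ac)
qed

end

lemma card_square_ge_parameters:
  assumes log: "12 * log 2 (4 * real B) \<le> real m" and Q: "20 * X\<^sup>2 * real B \<le> Q"
  shows "real (B * N ^ (n - 2)) * ((real m)\<^sup>2 / 4)
    \<le> real (card (algebraic_points n Q \<inter> ball x r \<times> ball y r))"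
proof -
  have "x \<noteq> y" using gap r by auto
  obtain U V where window:
    "\<bar>poly (real_poly (eisenstein_poly W u v)) t\<bar> \<le> 2 * real m * \<bar>t\<bar> + 4 * real m"
    if "u \<in> {U W..<U W + int m}" "v \<in> {V W..<V W + int m}" "t \<in> {x, y}" for W u v t
    using ex_small_value_window[OF \<open>x \<noteq> y\<close>, of m] by metis
  define G where "G W = {(u, v) \<in> {U W..<U W + int m} \<times> {V W..<V W + int m}.
    coprime (gcd (2 * u) (4 * v + 2)) (lead_coeff W)}" for W
  define F where "F = (SIGMA W:upper_polys (n - 2) B N. G W)"
  let ?P = "\<lambda>(W, u, v). eisenstein_poly W u v"
  have "finite (G W)" for W
    unfolding G_def by (rule finite_subset[of _ "{U W..<U W + int m} \<times> {V W..<V W + int m}"]) auto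
  hence card_F: "card F = (\<Sum>W\<in>upper_polys (n - 2) B N. card (G W))"
    by (simp add: F_def finite_upper_polys)
  have "real (B * N ^ (n - 2)) * ((real m)\<^sup>2 / 4) = (\<Sum>W\<in>upper_polys (n - 2) B N. (real m)\<^sup>2 / 4)"
    by (simp add: card_upper_polys)
  also have "\<dots> \<le> real (card F)"
    unfolding card_F of_nat_sum G_def using N log by (intro sum_mono card_coprime_window_ge)
  also have "card F = card (?P ` F)"
    by (intro card_image[symmetric] inj_onI) (auto simp: eisenstein_poly_def)
  also have "card (?P ` F) \<le> card (algebraic_points n Q \<inter> ball x r \<times> ball y r)"
  proof (rule card_le_card_algebraic_points)
    fix P assume "P \<in> ?P ` F"
    then obtain W u v where P: "P = eisenstein_poly W u v" and W: "W \<in> upper_polys (n - 2) B N"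
      and uv: "(u, v) \<in> G W" by (auto simp: F_def)
    have small: "\<bar>poly (real_poly P) t\<bar> \<le> 2 * real m * \<bar>t\<bar> + 4 * real m" if "t \<in> {x, y}" for t
      unfolding P using uv by (intro window that) (auto simp: G_def)
    show "degree P \<le> n" "lead_coeff P > 0"
      using lead_coeff_upper_polys(1)[OF W N] n degree_upper_polys[OF W]
        degree_eisenstein_poly_eq[OF W small[unfolded P]]
      by (auto simp: P coeff_eisenstein_poly)
    show "of_int \<bar>coeff P i\<bar> \<le> Q" for i
      using abs_coeff_eisenstein_poly_le[OF W small[unfolded P], of i] Q by (simp add: P)
    show "\<exists>\<alpha>\<in>ball x r \<times> ball y r. is_minimal_poly P \<alpha>"
      unfolding P using uv
      by (intro ex_minimal_poly_eisenstein_poly W small[unfolded P]) (auto simp: G_def)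
  qed
  finally show ?thesis by simp
qed

end

lemma nat_floor_mult_ge:
  fixes k s t :: real
  assumes "0 \<le> k" "s \<le> t" "1 \<le> k * s"
  shows "k / 2 * s \<le> real (nat \<lfloor>k * t\<rfloor>)"
proof -
  have "k * s \<le> k * t" using assms(1,2) by (rule mult_left_mono[rotated])
  moreover from this have "1 \<le> \<lfloor>k * t\<rfloor>" using assms(3) by simp
  ultimately have "k * s / 2 \<le> real (nat \<lfloor>k * t\<rfloor>)" by linarith
  thus ?thesis by simp
qed

context off_diagonal_square
begin

lemma square_parametersI:
  fixes \<gamma> \<mu> :: real
  assumes n: "n \<ge> 2" and X: "X \<ge> 1" and "B \<ge> 1"
    and \<gamma>: "\<gamma> \<le> 1" "8 * (real n)\<^sup>2 * X ^ (n - 1) * \<gamma> \<le> d" and \<mu>: "24 * X * \<mu> \<le> d"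
    and N: "real N \<le> \<gamma> * real B" and m: "real m \<le> \<mu> * (real B * r)"
  shows "square_parameters X d r x y n B N m"
proof
  have "\<gamma> * real B \<le> 1 * real B" using \<gamma>(1) by (intro mult_right_mono) auto
  thus "N \<le> B" using N by linarith
  have "8 * (real n)\<^sup>2 * real N * X ^ (n - 1) \<le> 8 * (real n)\<^sup>2 * (\<gamma> * real B) * X ^ (n - 1)"
    using N X by (intro mult_left_mono mult_right_mono) auto
  also have "\<dots> = real B * (8 * (real n)\<^sup>2 * X ^ (n - 1) * \<gamma>)" by simp
  also have "\<dots> \<le> real B * d" using \<gamma>(2) by (intro mult_left_mono) auto
  finally show "8 * (real n)\<^sup>2 * real N * X ^ (n - 1) \<le> real B * d" .
  have "24 * real m * X \<le> 24 * (\<mu> * (real B * r)) * X"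
    using m X by (intro mult_left_mono mult_right_mono) auto
  also have "\<dots> = real B * r * (24 * X * \<mu>)" by simp
  also have "\<dots> \<le> real B * r * d" using \<mu> r(1) by (intro mult_left_mono) auto
  finally show "24 * real m * X \<le> real B * d * r" by (simp only: mult_ac)
qed (use n X \<open>B \<ge> 1\<close> in auto)

lemma ex_square_parameters:
  fixes \<kappa> \<gamma> \<mu> :: real
  assumes n: "n \<ge> 2" and X: "X \<ge> 1"
    and \<kappa>: "0 < \<kappa>" "20 * X\<^sup>2 * \<kappa> \<le> 1"
    and \<gamma>: "0 < \<gamma>" "\<gamma> \<le> 1" "8 * (real n)\<^sup>2 * X ^ (n - 1) * \<gamma> \<le> d"
    and \<mu>: "0 < \<mu>" "24 * X * \<mu> \<le> d"
    and Q: "2 \<le> Q" "2 \<le> \<gamma> * \<kappa> * Q" "48 * log 2 Q \<le> \<mu> * \<kappa> * (Q * r)"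
  shows "\<exists>B N m. square_parameters X d r x y n B N m \<and>
    12 * log 2 (4 * real B) \<le> real m \<and> 20 * X\<^sup>2 * real B \<le> Q \<and>
    \<kappa> / 2 * Q \<le> real B \<and> \<gamma> * \<kappa> / 4 * Q \<le> real N \<and> \<mu> * \<kappa> / 4 * (Q * r) \<le> real m"
proof -
  define B N m where "B = nat \<lfloor>\<kappa> * Q\<rfloor>" and "N = nat \<lfloor>\<gamma> * real B\<rfloor>" and "m = nat \<lfloor>\<mu> * (real B * r)\<rfloor>"
  have "\<gamma> * \<kappa> * Q \<le> 1 * \<kappa> * Q" using \<gamma>(2) \<kappa>(1) Q(1) by (intro mult_right_mono) auto
  hence "2 \<le> \<kappa> * Q" using Q(2) by linarith
  hence B: "\<kappa> / 2 * Q \<le> real B" "real B \<le> \<kappa> * Q" "1 \<le> B"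
    using \<kappa>(1) nat_floor_mult_ge[of \<kappa> Q Q] by (simp_all add: B_def le_nat_iff)
  have N: "\<gamma> * \<kappa> / 4 * Q \<le> real N" "real N \<le> \<gamma> * real B"
    using nat_floor_mult_ge[OF _ B(1), of \<gamma>] Q(2) \<gamma>(1) by (simp_all add: N_def)
  have "1 \<le> log 2 Q" using Q(1) by (simp add: le_log_iff)
  have "\<kappa> / 2 * Q * r \<le> real B * r" using B(1) r(1) by (intro mult_right_mono) auto
  hence m: "\<mu> * \<kappa> / 4 * (Q * r) \<le> real m" "real m \<le> \<mu> * (real B * r)"
    using nat_floor_mult_ge[of \<mu> "\<kappa> / 2 * Q * r" "real B * r"] Q(3) \<mu>(1) r(1) \<open>1 \<le> log 2 Q\<close>
    by (simp_all add: m_def)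
  have "20 * X\<^sup>2 * real B \<le> 20 * X\<^sup>2 * \<kappa> * Q"
    using B(2) by (simp only: mult.assoc) (intro mult_left_mono; simp)
  also have "\<dots> \<le> 1 * Q" using \<kappa>(2) Q(1) by (intro mult_right_mono) auto
  finally have height_le: "20 * X\<^sup>2 * real B \<le> Q" by simp
  have "1 \<le> X\<^sup>2" using X by simp
  hence "4 * real B \<le> 20 * X\<^sup>2 * real B" by (intro mult_right_mono) auto
  hence "4 * real B \<le> Q" using height_le by linarith
  hence "log 2 (4 * real B) \<le> log 2 Q" using B(3) Q(1) by simp
  moreover have "12 * log 2 Q \<le> \<mu> * \<kappa> / 4 * (Q * r)" using Q(3) by simp
  ultimately have "12 * log 2 (4 * real B) \<le> real m" using m(1) by linarith
  moreover have "square_parameters X d r x y n B N m"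
    using n X B(3) \<gamma>(2,3) \<mu>(2) N(2) m(2) by (rule square_parametersI)
  ultimately show ?thesis using height_le B(1) N(1) m(1) by blast
qed

lemma log_scale_bounds:
  fixes \<alpha> \<beta> Q :: real
  assumes pos: "0 < \<alpha>" "0 < \<beta>"
    and Q: "2 \<le> Q" "(48 / \<alpha> + d / \<beta>) * log 2 Q \<le> Q * r"
  shows "2 \<le> \<beta> * Q" "48 * log 2 Q \<le> \<alpha> * (Q * r)"
proof -
  let ?C = "48 / \<alpha> + d / \<beta>"
  have "1 \<le> log 2 Q" using Q(1) by (simp add: le_log_iff)
  hence "48 / \<alpha> * log 2 Q \<le> ?C * log 2 Q" "d / \<beta> * 1 \<le> ?C * log 2 Q"
    using pos d_pos by (intro mult_mono; simp)+
  hence "48 / \<alpha> * log 2 Q \<le> Q * r" "d / \<beta> \<le> Q * r" using Q(2) by linarith+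
  thus "48 * log 2 Q \<le> \<alpha> * (Q * r)" using pos(1) by (simp add: field_simps)
  note \<open>d / \<beta> \<le> Q * r\<close>
  also have "Q * r \<le> Q * (d / 8)" using r(2) Q(1) by (intro mult_left_mono) auto
  finally have "d / \<beta> \<le> Q * (d / 8)" .
  hence "d * 8 \<le> d * (\<beta> * Q)" using pos(2) by (simp add: field_simps)
  thus "2 \<le> \<beta> * Q" using d_pos by simp
qed

end

text \<open>The lower bound on \<open>Q r\<close> makes the ranges of \<open>a\<^sub>0\<close> and \<open>a\<^sub>1\<close> long compared with the number of
  prime factors of \<open>a\<^sub>n\<close>.\<close>
lemma card_algebraic_points_square_ge:
  assumes n: "n \<ge> 2" and X: "X \<ge> 1" and d: "d > 0"
  obtains c C where "c > 0" "C > 0"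
    "\<And>Q r x y. off_diagonal_square X d r x y \<Longrightarrow> 2 \<le> Q \<Longrightarrow> C * log 2 Q \<le> Q * r \<Longrightarrow>
      c * Q ^ (n + 1) * r\<^sup>2 \<le> real (card (algebraic_points n Q \<inter> ball x r \<times> ball y r))"
proof -
  define \<kappa> \<gamma> \<mu> where "\<kappa> = 1 / (20 * X\<^sup>2)" and "\<gamma> = min 1 (d / (8 * (real n)\<^sup>2 * X ^ (n - 1)))"
    and "\<mu> = d / (24 * X)"
  have \<kappa>: "0 < \<kappa>" "20 * X\<^sup>2 * \<kappa> \<le> 1" and \<mu>: "0 < \<mu>" "24 * X * \<mu> \<le> d"
    using X d by (simp_all add: \<kappa>_def \<mu>_def)
  have \<gamma>: "0 < \<gamma>" "\<gamma> \<le> 1" "8 * (real n)\<^sup>2 * X ^ (n - 1) * \<gamma> \<le> d"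
    using n X d by (simp_all add: \<gamma>_def min_def field_simps)
  define c C where "c = \<kappa> / 2 * (\<gamma> * \<kappa> / 4) ^ (n - 2) * ((\<mu> * \<kappa> / 4)\<^sup>2 / 4)"
    and "C = 48 / (\<mu> * \<kappa>) + d / (\<gamma> * \<kappa>)"
  show ?thesis
  proof
    show "c > 0" "C > 0" using \<kappa> \<mu> \<gamma> d by (simp_all add: c_def C_def add_pos_pos)
    fix Q r x y :: real
    assume "off_diagonal_square X d r x y" and Q: "2 \<le> Q" "C * log 2 Q \<le> Q * r"
    then interpret off_diagonal_square X d r x y by simp
    have "2 \<le> \<gamma> * \<kappa> * Q" "48 * log 2 Q \<le> \<mu> * \<kappa> * (Q * r)"
      using log_scale_bounds[of "\<mu> * \<kappa>" "\<gamma> * \<kappa>" Q] \<kappa> \<mu> \<gamma> Q by (simp_all add: C_def)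
    then obtain B N m where parameters: "square_parameters X d r x y n B N m"
      and log_and_height: "12 * log 2 (4 * real B) \<le> real m" "20 * X\<^sup>2 * real B \<le> Q"
      and parameters_ge:
        "\<kappa> / 2 * Q \<le> real B" "\<gamma> * \<kappa> / 4 * Q \<le> real N" "\<mu> * \<kappa> / 4 * (Q * r) \<le> real m"
      using ex_square_parameters[OF n X \<kappa> \<gamma> \<mu> Q(1)] by blast
    have "n + 1 = 1 + (n - 2) + 2" using n by simp
    hence "Q ^ (n + 1) = Q * Q ^ (n - 2) * Q\<^sup>2" by (simp only: power_add power_one_right)
    hence "c * Q ^ (n + 1) * r\<^sup>2
        = \<kappa> / 2 * Q * (\<gamma> * \<kappa> / 4 * Q) ^ (n - 2) * ((\<mu> * \<kappa> / 4 * (Q * r))\<^sup>2 / 4)"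
      by (simp only: c_def power_mult_distrib) simp
    also have "\<dots> \<le> real B * real N ^ (n - 2) * ((real m)\<^sup>2 / 4)"
      using parameters_ge \<kappa> \<gamma> \<mu> Q(1) r(1) by (intro mult_mono divide_right_mono power_mono) auto
    also have "\<dots> \<le> real (card (algebraic_points n Q \<inter> ball x r \<times> ball y r))"
      using square_parameters.card_square_ge_parameters[OF parameters log_and_height]
      by simp
    finally show
      "c * Q ^ (n + 1) * r\<^sup>2 \<le> real (card (algebraic_points n Q \<inter> ball x r \<times> ball y r))" .
  qed
qed

section \<open>Points near a graph\<close>

definition graph_nbhd :: "(real \<Rightarrow> real) \<Rightarrow> real set \<Rightarrow> real \<Rightarrow> (real \<times> real) set" where
  "graph_nbhd f J r = (\<Union>x\<in>{x. ball x r \<subseteq> J}. ball x r \<times> ball (f x) r)"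

lemma graph_nbhd_subset_strip:
  assumes lip: "c5-lipschitz_on J f" and "c3 \<ge> 2" "Q > 0"
  shows "graph_nbhd f J (Q powr - l) \<subseteq> strip J f c5 c3 Q l"
proof
  define r where "r = Q powr - l"
  have "c5 \<ge> 0" using lip by (rule lipschitz_on_nonneg)
  fix \<alpha> assume "\<alpha> \<in> graph_nbhd f J (Q powr - l)"
  then obtain x z1 z2 where \<alpha>: "\<alpha> = (z1, z2)" and x: "ball x r \<subseteq> J"
    and z: "z1 \<in> ball x r" "z2 \<in> ball (f x) r"
    by (auto simp: graph_nbhd_def r_def)
  have "x \<in> J" "z1 \<in> J" using x z \<open>Q > 0\<close> by (auto simp: r_def)
  hence "\<bar>f x - f z1\<bar> \<le> c5 * \<bar>x - z1\<bar>"
    using lipschitz_onD[OF lip] by (simp add: dist_real_def)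
  also have "\<dots> \<le> c5 * r"
    using z(1) \<open>c5 \<ge> 0\<close> by (intro mult_left_mono) (auto simp: dist_real_def)
  finally have "\<bar>z2 - f z1\<bar> < (1 + c5) * r"
    using z(2) by (auto simp: dist_real_def distrib_right)
  also have "\<dots> \<le> (1/2 + c5) * c3 * r"
  proof (rule mult_right_mono)
    have "1 + c5 \<le> (1/2 + c5) * 2" using \<open>c5 \<ge> 0\<close> by simp
    also have "\<dots> \<le> (1/2 + c5) * c3" using \<open>c5 \<ge> 0\<close> \<open>c3 \<ge> 2\<close> by (intro mult_left_mono) auto
    finally show "1 + c5 \<le> (1/2 + c5) * c3" .
  qed (simp add: r_def)
  finally show "\<alpha> \<in> strip J f c5 c3 Q l"
    using \<open>z1 \<in> J\<close> by (simp add: \<alpha> strip_def r_def)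
qed

lemma ex_disjoint_balls_Icc:
  fixes p q r :: real
  assumes r: "0 < r" and pq: "2 * r \<le> q - p"
  obtains S where "finite S" "(q - p) / (4 * r) \<le> real (card S)"
    "\<And>x. x \<in> S \<Longrightarrow> ball x r \<subseteq> {p..q}" "disjoint_family_on (\<lambda>x. ball x r) S"
proof -
  define K where "K = nat \<lfloor>(q - p) / (2 * r)\<rfloor>"
  define centre where "centre k = p + (2 * real k + 1) * r" for k
  have "1 \<le> (q - p) / (2 * r)" using r pq by (simp add: le_divide_eq)
  hence K_ge: "(q - p) / (2 * r) / 2 \<le> real K"
    using nat_floor_mult_ge[of 1 "(q - p) / (2 * r)" "(q - p) / (2 * r)"] by (simp add: K_def)
  have separated: "2 * r \<le> dist (centre j) (centre k)" if "j \<noteq> k" for j k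
  proof -
    have "1 \<le> \<bar>real j - real k\<bar>" using that by linarith
    hence "2 * r * 1 \<le> 2 * r * \<bar>real j - real k\<bar>" using r by (intro mult_left_mono) auto
    also have "\<dots> = \<bar>2 * r * (real j - real k)\<bar>" using r by (simp add: abs_mult)
    also have "\<dots> = dist (centre j) (centre k)" by (simp add: centre_def dist_real_def algebra_simps)
    finally show ?thesis by simp
  qed
  show thesis
  proof (rule that[of "centre ` {..<K}"])
    have "inj centre" by (rule injI) (use separated r in force)
    hence "card (centre ` {..<K}) = K" by (simp add: card_image inj_on_subset)
    thus "(q - p) / (4 * r) \<le> real (card (centre ` {..<K}))" using K_ge by simp
    show "disjoint_family_on (\<lambda>x. ball x r) (centre ` {..<K})"
    proof (unfold disjoint_family_on_def, intro ballI impI)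
      fix x x' assume "x \<in> centre ` {..<K}" "x' \<in> centre ` {..<K}" "x \<noteq> x'"
      then obtain j k where "x = centre j" "x' = centre k" "j \<noteq> k" by auto
      thus "ball x r \<inter> ball x' r = {}" using separated[of j k] by (intro disjoint_ballI) simp
    qed
    fix x assume "x \<in> centre ` {..<K}"
    then obtain k where k: "k < K" "x = centre k" by auto
    have "real k + 1 \<le> real K" using k(1) by linarith
    also have "real K \<le> (q - p) / (2 * r)" unfolding K_def using r pq by simp
    finally have "(real k + 1) * (2 * r) \<le> q - p" using r by (simp add: field_simps)
    moreover have "0 \<le> real k * r" using r by simp
    ultimately have "p \<le> centre k - r" "centre k + r \<le> q"
      by (simp_all add: centre_def algebra_simps)
    thus "ball x r \<subseteq> {p..q}" by (auto simp: k(2) dist_real_def)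
  qed simp
qed

lemma ex_subinterval_bounded_below:
  fixes g :: "real \<Rightarrow> real"
  assumes "a < b" and cont: "continuous_on {a..b} g" and fin: "finite {x \<in> {a..b}. g x = 0}"
  obtains p q d where "p < q" "d > 0" "{p..q} \<subseteq> {a..b}" "\<And>x. x \<in> {p..q} \<Longrightarrow> d \<le> \<bar>g x\<bar>"
proof -
  let ?U = "{a<..<b} \<inter> g -` (- {0})"
  have "\<not> {a<..<b} \<subseteq> {x \<in> {a..b}. g x = 0}"
    using finite_subset[OF _ fin] infinite_Ioo[OF \<open>a < b\<close>] by blast
  then obtain x0 where "x0 \<in> ?U" by force
  moreover have "open ?U"
    by (intro continuous_open_preimage continuous_on_subset[OF cont]) auto
  ultimately obtain e where e: "e > 0" "{x0 - e..x0 + e} \<subseteq> ?U"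
    unfolding cball_eq_atLeastAtMost[symmetric] using open_contains_cball by blast
  hence sub: "{x0 - e..x0 + e} \<subseteq> {a..b}" by force
  have "continuous_on {x0 - e..x0 + e} (\<lambda>x. \<bar>g x\<bar>)"
    using sub by (intro continuous_intros continuous_on_subset[OF cont])
  then obtain z where z: "z \<in> {x0 - e..x0 + e}" "\<And>x. x \<in> {x0 - e..x0 + e} \<Longrightarrow> \<bar>g z\<bar> \<le> \<bar>g x\<bar>"
    using continuous_attains_inf[of "{x0 - e..x0 + e}" "\<lambda>x. \<bar>g x\<bar>"] e(1) by auto
  show thesis
  proof (rule that[of "x0 - e" "x0 + e" "\<bar>g z\<bar>"])
    show "\<bar>g z\<bar> > 0" using e(2) z(1) by auto
  qed (use e(1) sub z(2) in auto)
qed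

lemma sum_card_squares_le_card_graph_nbhd:
  assumes S: "finite S" "\<And>x. x \<in> S \<Longrightarrow> ball x r \<subseteq> J" and disj: "disjoint_family_on (\<lambda>x. ball x r) S"
  shows "(\<Sum>x\<in>S. card (algebraic_points n Q \<inter> ball x r \<times> ball (f x) r))
    \<le> card (algebraic_points n Q \<inter> graph_nbhd f J r)"
proof -
  let ?A = "\<lambda>x. algebraic_points n Q \<inter> ball x r \<times> ball (f x) r"
  have "(\<Sum>x\<in>S. card (?A x)) = card (\<Union>x\<in>S. ?A x)"
    using S(1) disj finite_algebraic_points[of n Q]
    by (intro card_UN_disjoint[symmetric]) (auto simp: disjoint_family_on_def)
  also have "\<dots> \<le> card (algebraic_points n Q \<inter> graph_nbhd f J r)"
    using S(2) finite_algebraic_points[of n Q]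
    by (intro card_mono) (auto simp: graph_nbhd_def)
  finally show ?thesis .
qed

lemma card_graph_nbhd_ge_of_squares:
  assumes r: "0 < r" "2 * r \<le> q - p" and J: "{p..q} \<subseteq> J" and "0 \<le> k"
    and squares_ge:
      "\<And>x. x \<in> {p..q} \<Longrightarrow> k \<le> real (card (algebraic_points n Q \<inter> ball x r \<times> ball (f x) r))"
  shows "(q - p) / (4 * r) * k \<le> real (card (algebraic_points n Q \<inter> graph_nbhd f J r))"
proof -
  obtain S where S: "finite S" "\<And>x. x \<in> S \<Longrightarrow> ball x r \<subseteq> {p..q}" "disjoint_family_on (\<lambda>x. ball x r) S"
    and card_S_ge: "(q - p) / (4 * r) \<le> real (card S)"
    by (rule ex_disjoint_balls_Icc[OF r]) (rule that)
  have "(q - p) / (4 * r) * k \<le> real (card S) * k"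
    using card_S_ge \<open>0 \<le> k\<close> by (rule mult_right_mono)
  also have "\<dots> = (\<Sum>x\<in>S. k)" by simp
  also have "\<dots> \<le> (\<Sum>x\<in>S. real (card (algebraic_points n Q \<inter> ball x r \<times> ball (f x) r)))"
  proof (intro sum_mono squares_ge)
    show "x \<in> {p..q}" if "x \<in> S" for x using S(2)[OF that] r(1) by (meson centre_in_ball subsetD)
  qed
  also have "\<dots> \<le> real (card (algebraic_points n Q \<inter> graph_nbhd f J r))"
    unfolding of_nat_sum[symmetric] of_nat_le_iff
    using S(1,3) order_trans[OF S(2) J] by (intro sum_card_squares_le_card_graph_nbhd)
  finally show ?thesis .
qed

lemma card_algebraic_points_graph_nbhd_ge:
  fixes f :: "real \<Rightarrow> real"
  assumes n: "n \<ge> 2" and "a < b" and cont: "continuous_on {a..b} f"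
    and fin: "finite {x \<in> {a..b}. f x = x}"
  obtains c C \<rho> where "c > 0" "C > 0" "\<rho> > 0"
    "\<And>Q r. 0 < r \<Longrightarrow> r \<le> \<rho> \<Longrightarrow> 2 \<le> Q \<Longrightarrow> C * log 2 Q \<le> Q * r \<Longrightarrow>
      c * Q ^ (n + 1) * r \<le> real (card (algebraic_points n Q \<inter> graph_nbhd f {a..b} r))"
proof -
  obtain p q d where pq: "p < q" "{p..q} \<subseteq> {a..b}" and d_pos: "d > 0"
    and gap: "\<And>x. x \<in> {p..q} \<Longrightarrow> d \<le> \<bar>x - f x\<bar>"
  proof (rule ex_subinterval_bounded_below[OF \<open>a < b\<close>])
    show "continuous_on {a..b} (\<lambda>x. x - f x)" by (intro continuous_intros cont)
    have "{x \<in> {a..b}. x - f x = 0} = {x \<in> {a..b}. f x = x}" by auto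
    thus "finite {x \<in> {a..b}. x - f x = 0}" using fin by simp
  qed (rule that)
  obtain M where f_le: "\<forall>x\<in>{a..b}. \<bar>f x\<bar> \<le> M"
    using compact_imp_bounded[OF compact_continuous_image[OF cont compact_Icc]]
    by (auto simp: bounded_iff)
  define X where "X = 1 + \<bar>a\<bar> + \<bar>b\<bar> + \<bar>M\<bar>"
  have X_ge: "\<bar>x\<bar> + 1 \<le> X" "\<bar>f x\<bar> + 1 \<le> X" if "x \<in> {a..b}" for x
    using f_le[rule_format, OF that] that by (auto simp: X_def)
  obtain c C where c_pos: "c > 0" and C_pos: "C > 0" and square_ge:
    "\<And>Q r x y. off_diagonal_square X d r x y \<Longrightarrow> 2 \<le> Q \<Longrightarrow> C * log 2 Q \<le> Q * r \<Longrightarrow>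
      c * Q ^ (n + 1) * r\<^sup>2 \<le> real (card (algebraic_points n Q \<inter> ball x r \<times> ball y r))"
    by (rule card_algebraic_points_square_ge[OF n _ d_pos, of X]) (simp add: X_def, rule that)
  define \<rho> where "\<rho> = min 1 (min (d / 8) ((q - p) / 2))"
  have "c * (q - p) / 4 * Q ^ (n + 1) * r
      \<le> real (card (algebraic_points n Q \<inter> graph_nbhd f {a..b} r))"
    if r: "0 < r" "r \<le> \<rho>" and Q: "2 \<le> Q" "C * log 2 Q \<le> Q * r" for Q r
  proof -
    have r_le: "r \<le> 1" "r \<le> d / 8" "2 * r \<le> q - p" using r(2) by (auto simp: \<rho>_def)
    have "c * (q - p) / 4 * Q ^ (n + 1) * r = (q - p) / (4 * r) * (c * Q ^ (n + 1) * r\<^sup>2)"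
      using r(1) by (simp add: power2_eq_square)
    also have "\<dots> \<le> real (card (algebraic_points n Q \<inter> graph_nbhd f {a..b} r))"
    proof (rule card_graph_nbhd_ge_of_squares[OF r(1) r_le(3) pq(2)])
      show "0 \<le> c * Q ^ (n + 1) * r\<^sup>2" using c_pos Q(1) by simp
      fix x assume x: "x \<in> {p..q}"
      hence "x \<in> {a..b}" using pq(2) by auto
      hence "off_diagonal_square X d r x (f x)"
        using r(1) r_le(1,2) gap[OF x] X_ge[of x] by unfold_locales linarith+
      thus "c * Q ^ (n + 1) * r\<^sup>2 \<le> real (card (algebraic_points n Q \<inter> ball x r \<times> ball (f x) r))"
        using Q by (rule square_ge)
    qed
    finally show ?thesis .
  qed
  thus ?thesis
    using c_pos C_pos d_pos pq(1) by (intro that[of "c * (q - p) / 4" C \<rho>]) (auto simp: \<rho>_def)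
qed

lemma eventually_log_le_powr:
  fixes C \<rho> l :: real
  assumes "0 < l" "l < 1" "0 < C" "0 < \<rho>"
  shows "\<forall>\<^sub>F Q in at_top. 2 \<le> Q \<and> C * log 2 Q \<le> Q * Q powr - l \<and> Q powr - l \<le> \<rho>"
proof (intro eventually_conj)
  show "\<forall>\<^sub>F Q in at_top. 2 \<le> (Q::real)" by (rule eventually_ge_at_top)
  have "filterlim (\<lambda>Q. Q * Q powr - l - C * log 2 Q) at_top at_top" using assms by real_asymp
  hence "\<forall>\<^sub>F Q in at_top. 0 \<le> Q * Q powr - l - C * log 2 Q"
    unfolding filterlim_at_top by blast
  thus "\<forall>\<^sub>F Q in at_top. C * log 2 Q \<le> Q * Q powr - l" by simp
  have "((\<lambda>Q. Q powr - l) \<longlongrightarrow> 0) at_top" using assms by real_asymp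
  hence "\<forall>\<^sub>F Q in at_top. Q powr - l < \<rho>" using assms(4) by (rule order_tendstoD(2))
  thus "\<forall>\<^sub>F Q in at_top. Q powr - l \<le> \<rho>" by eventually_elim simp
qed

lemma lipschitz_on_SUP_deriv:
  fixes f f' :: "real \<Rightarrow> real"
  assumes "convex J" "J \<noteq> {}" and deriv: "\<And>x. x \<in> J \<Longrightarrow> (f has_real_derivative f' x) (at x within J)"
    and bdd: "bdd_above ((\<lambda>x. \<bar>f' x\<bar>) ` J)"
  shows "(SUP x\<in>J. \<bar>f' x\<bar>)-lipschitz_on J f"
proof (rule lipschitz_onI)
  have upper: "\<bar>f' x\<bar> \<le> (SUP x\<in>J. \<bar>f' x\<bar>)" if "x \<in> J" for x
    using that bdd by (rule cSUP_upper)
  show "dist (f x) (f y) \<le> (SUP x\<in>J. \<bar>f' x\<bar>) * dist x y" if "x \<in> J" "y \<in> J" for x y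
    unfolding dist_norm using \<open>convex J\<close> deriv upper that
    by (intro field_differentiable_bound) auto
  show "0 \<le> (SUP x\<in>J. \<bar>f' x\<bar>)"
    using \<open>J \<noteq> {}\<close> upper by (meson abs_ge_zero all_not_in_conv order_trans)
qed

lemma card_graph_nbhd_le_card_strip:
  assumes "c5-lipschitz_on J f" "c3 \<ge> 2" "Q > 0"
  shows "card (algebraic_points n Q \<inter> graph_nbhd f J (Q powr - l))
    \<le> card (algebraic_points n Q \<inter> strip J f c5 c3 Q l)"
  using graph_nbhd_subset_strip[OF assms]
  by (intro card_mono Int_mono) (auto simp: finite_algebraic_points)

lemma eventually_card_algebraic_points_strip_ge:
  assumes n: "n \<ge> 2" and "a < b" and lip: "c5-lipschitz_on {a..b} f"
    and fin: "finite {x \<in> {a..b}. f x = x}"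
  shows "\<exists>c>0. \<forall>l. 0 < l \<and> l < 1 \<longrightarrow> (\<forall>\<^sub>F Q in at_top. \<forall>c3\<ge>2.
    c * Q powr (real n + 1 - l) \<le> real (card (algebraic_points n Q \<inter> strip {a..b} f c5 c3 Q l)))"
proof -
  obtain c C \<rho> where pos: "c > 0" "C > 0" "\<rho> > 0" and graph:
    "\<And>Q r. 0 < r \<Longrightarrow> r \<le> \<rho> \<Longrightarrow> 2 \<le> Q \<Longrightarrow> C * log 2 Q \<le> Q * r \<Longrightarrow>
      c * Q ^ (n + 1) * r \<le> real (card (algebraic_points n Q \<inter> graph_nbhd f {a..b} r))"
    using lipschitz_on_continuous_on[OF lip]
    by (rule card_algebraic_points_graph_nbhd_ge[OF n \<open>a < b\<close> _ fin]) (rule that)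
  have "\<forall>\<^sub>F Q in at_top. \<forall>c3\<ge>2. c * Q powr (real n + 1 - l)
      \<le> real (card (algebraic_points n Q \<inter> strip {a..b} f c5 c3 Q l))" if "0 < l" "l < 1" for l
    using eventually_log_le_powr[OF that pos(2,3)]
  proof eventually_elim
    case (elim Q)
    hence "c * Q powr (real n + 1 - l) = c * Q ^ (n + 1) * Q powr - l"
      by (simp add: powr_add powr_diff powr_minus_divide powr_realpow)
    also have "\<dots> \<le> real (card (algebraic_points n Q \<inter> graph_nbhd f {a..b} (Q powr - l)))"
      using elim by (intro graph) auto
    finally show ?case using card_graph_nbhd_le_card_strip[OF lip, of _ Q n l] elim by force
  qed
  thus ?thesis using pos(1) by blast
qed

theorem theorem3:
  fixes n :: nat and a b c5 :: real and f f' :: "real \<Rightarrow> real"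
  assumes "n \<ge> 2" and "a < b"
    and "\<And>x. x \<in> {a..b} \<Longrightarrow> (f has_real_derivative f' x) (at x within {a..b})"
    and "continuous_on {a..b} f'"
    and "bdd_above ((\<lambda>x. \<bar>f' x\<bar>) ` {a..b})"
    and "c5 = (SUP x\<in>{a..b}. \<bar>f' x\<bar>)"
    and "finite {x \<in> {a..b}. f x = x}"
  shows "\<exists>C3>0. \<exists>c6>0. \<forall>l. 0 < l \<and> l < 3/4 \<longrightarrow>
           (\<exists>Q0>0. \<forall>c3\<ge>C3. \<forall>Q>Q0.
              real (card (algebraic_points n Q \<inter> strip {a..b} f c5 c3 Q l))
                \<ge> c6 * Q powr (real n + 1 - l))"
proof -
  have "c5-lipschitz_on {a..b} f"
    unfolding assms(6) using assms(2,3,5) by (intro lipschitz_on_SUP_deriv) auto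
  then obtain c where "c > 0" and
    ev: "\<And>l. 0 < l \<Longrightarrow> l < 1 \<Longrightarrow> \<forall>\<^sub>F Q in at_top. \<forall>c3\<ge>2. c * Q powr (real n + 1 - l)
      \<le> real (card (algebraic_points n Q \<inter> strip {a..b} f c5 c3 Q l))"
    using eventually_card_algebraic_points_strip_ge assms(1,2,7) by blast
  have "\<exists>Q0>0. \<forall>c3\<ge>2. \<forall>Q>Q0. c * Q powr (real n + 1 - l)
      \<le> real (card (algebraic_points n Q \<inter> strip {a..b} f c5 c3 Q l))" if "0 < l \<and> l < 3/4" for l
  proof -
    have "\<forall>\<^sub>F Q in at_top. \<forall>c3\<ge>2. c * Q powr (real n + 1 - l)
        \<le> real (card (algebraic_points n Q \<inter> strip {a..b} f c5 c3 Q l))"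
      using that by (intro ev) auto
    then obtain Q0 where "\<forall>Q>Q0. \<forall>c3\<ge>2. c * Q powr (real n + 1 - l)
        \<le> real (card (algebraic_points n Q \<inter> strip {a..b} f c5 c3 Q l))"
      unfolding eventually_at_top_dense by blast
    thus ?thesis by (intro exI[of _ "max Q0 1"]) auto
  qed
  thus ?thesis using \<open>c > 0\<close> by (intro exI[of _ 2] exI[of _ c]) auto
qed

end
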